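(* Fix an integer $\kappa\ge1$ and a real number $c>0$. Then, asymptotically almost surely, for all $1\le k\le\kappa$ the number of connected components of order $k$ (that is, with exactly $k$ vertices) in the random graph $\mathbb{G}(n,\lfloor cn\rfloor)$ is asymptotically equal to $$\frac{k^{k-2}}{k!}(2c)^{k-1}e^{-2kc}\,n .$$
   Context: All asymptotics are as $n\to\infty$. $\mathbb{G}(n,m)$ denotes the Erdős–Rényi random graph: a graph chosen uniformly at random from all labeled graphs on $n$ vertices with exactly $m$ edges (defined for $n$ large enough that $m=\lfloor cn\rfloor\le\binom n2$). "Asymptotically almost surely, a random variable $X$ (depending on $n$) is asymptotically equal to $x$ (depending on $n$)" means that there is a sequence $\varepsilon_n=o(1)$ such that $$\lim_{n\to\infty}\Pr\left[(1-\varepsilon_n)x\le X\le(1+\varepsilon_n)x\right]=1 .$$ *)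

theory Defs
  imports "HOL-Probability.Probability" "Graph_Theory.Graph_Theory"
begin

text \<open>
  A simple undirected graph is a symmetric loop-free digraph without parallel arcs
  (\<^locale>\<open>pair_graph\<close>); every edge \<open>{u, v}\<close> is represented by the two arcs
  \<open>(u, v)\<close> and \<open>(v, u)\<close>.
\<close>

definition edges :: "'a pair_pre_digraph \<Rightarrow> 'a set set" where
  "edges G = {{u, v} | u v. (u, v) \<in> parcs G}"

definition labeled_graphs :: "nat \<Rightarrow> nat \<Rightarrow> nat pair_pre_digraph set" where
  "labeled_graphs n m = {G. pair_graph G \<and> pverts G = {1..n} \<and> card (edges G) = m}"

text \<open>
  Only meaningful for \<open>m \<le> n choose 2\<close>: otherwise \<^const>\<open>pmf_of_set\<close> is applied to the
  empty set and yields an unspecified distribution.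
\<close>

definition random_graph :: "nat \<Rightarrow> nat \<Rightarrow> nat pair_pre_digraph pmf" where
  "random_graph n m = pmf_of_set (labeled_graphs n m)"

text \<open>
  Connected components are maximal connected subgraphs. The library's
  \<^const>\<open>Digraph_Component.connected\<close> ignores arc directions and excludes the graph
  without vertices; a maximal connected subgraph of a symmetric digraph contains all arcs
  between its vertices and is therefore again symmetric.
\<close>

definition components :: "'a pair_pre_digraph \<Rightarrow> ('a, 'a \<times> 'a) pre_digraph set" where
  "components G = {H. pre_digraph.max_subgraph (with_proj G) Digraph_Component.connected H}"

definition num_components :: "nat \<Rightarrow> 'a pair_pre_digraph \<Rightarrow> nat" where
  "num_components k G = card {H \<in> components G. card (verts H) = k}"

text \<open>
  The random variables \<open>X k n\<close>, \<open>k \<in> K\<close>, defined on the \<open>n\<close>-th probability space, are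
  asymptotically almost surely all asymptotically equal to \<open>x k n\<close>: the estimates hold
  jointly for all \<open>k \<in> K\<close>, with a common error sequence. For a singleton \<open>K\<close> this is the
  notion for one random variable.
\<close>

definition aas_asymp_equal ::
  "'k set \<Rightarrow> (nat \<Rightarrow> 'a pmf) \<Rightarrow> ('k \<Rightarrow> nat \<Rightarrow> 'a \<Rightarrow> real) \<Rightarrow> ('k \<Rightarrow> nat \<Rightarrow> real) \<Rightarrow> bool" where
  "aas_asymp_equal K P X x \<longleftrightarrow>
     (\<exists>\<epsilon> :: nat \<Rightarrow> real. \<epsilon> \<longlonglongrightarrow> 0 \<and>
        (\<lambda>n. measure_pmf.prob (P n)
           {\<omega>. \<forall>k\<in>K. (1 - \<epsilon> n) * x k n \<le> X k n \<omega> \<and> X k n \<omega> \<le> (1 + \<epsilon> n) * x k n})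
        \<longlonglongrightarrow> 1)"

end

theory Submission
  imports Defs "HOL-Real_Asymp.Real_Asymp"
begin

text \<open>
  Second moment method. A fixed \<open>k\<close>-set is a component if it carries a connected graph, with
  \<open>j\<close> edges say, and the other \<open>m - j\<close> edges avoid it; this has probability
  of order \<open>n ^ (-j)\<close>. Since \<open>j \<ge> k - 1\<close>, only trees contribute in the limit, and by Cayley's
  formula there are \<open>k ^ (k - 2)\<close> of them. The same computation for two disjoint \<open>k\<close>-sets shows
  that the two events are asymptotically independent, so that the mean square deviation of the
  number of components from its asymptotic value is \<open>o (n ^ 2)\<close>, and Chebyshev's inequality applies.

  Cayley's formula is obtained by letting a forest grow edge by edge while counting the possible
  choices of roots, as in Pitman's proof.
\<close>

section \<open>Connectivity classes and Cayley's formula\<close>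

text \<open>Of the \<open>n choose 2\<close> pairs about \<open>k * n\<close> meet a fixed
  \<open>k\<close>-set, a fraction of \<open>2 * k / n\<close>, so about \<open>c * n\<close> edges
  all miss them with probability near \<open>exp (- 2 * k * c)\<close>. Prescribing \<open>j\<close>
  of the edges costs a further factor of about \<open>(m / (n ^ 2 / 2)) ^ j\<close>, that is
  \<open>(2 * c / n) ^ j\<close>. These are the constants of the limit.

  Edges are drawn without replacement, so their positions are not independent. All probabilities are
  therefore kept as exact quotients of counts, and only quotients of binomial coefficients are
  estimated. The sums over the number of edges inside the \<open>k\<close>-set run up to
  \<open>m\<close>, which grows with \<open>n\<close>, but at most \<open>k choose 2\<close> edges
  fit there.

  The number of ways to add an edge to a forest without closing a cycle depends on the sizes of its
  trees; weighting by choices of roots removes this dependence.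

  Everything is counted for sets of edges, where splitting a graph means intersecting sets; digraphs
  are reduced to these by a bijection.\<close>

definition vertex_pairs :: "'a set \<Rightarrow> 'a set set" where
  "vertex_pairs V = {e. e \<subseteq> V \<and> card e = 2}"

text \<open>The closure is reflexive on the whole type, so isolated vertices get classes of their
  own; the vertex set has to be supplied only in \<open>classes\<close>.\<close>

definition joined :: "'a set set \<Rightarrow> 'a rel" where
  "joined E = {(u, v). {u, v} \<in> E}\<^sup>*"

definition class_of :: "'a set set \<Rightarrow> 'a \<Rightarrow> 'a set" where
  "class_of E u = joined E `` {u}"

definition classes :: "'a set \<Rightarrow> 'a set set \<Rightarrow> 'a set set" where
  "classes V E = class_of E ` V"

lemma finite_vertex_pairs: "finite V \<Longrightarrow> finite (vertex_pairs V)"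
  by (rule finite_subset[of _ "Pow V"]) (auto simp: vertex_pairs_def)

lemma card_vertex_pairs: "finite V \<Longrightarrow> card (vertex_pairs V) = card V choose 2"
  by (simp add: vertex_pairs_def n_subsets)

lemma mem_vertex_pairs: "{u, v} \<in> vertex_pairs V \<longleftrightarrow> u \<in> V \<and> v \<in> V \<and> u \<noteq> v"
  by (cases "u = v") (auto simp: vertex_pairs_def)

lemma vertex_pairsE:
  assumes "e \<in> vertex_pairs V"
  obtains u v where "e = {u, v}" "u \<in> V" "v \<in> V" "u \<noteq> v"
  using assms unfolding vertex_pairs_def card_2_iff by auto

lemma vertex_pairs_mono: "A \<subseteq> B \<Longrightarrow> vertex_pairs A \<subseteq> vertex_pairs B"
  by (auto simp: vertex_pairs_def)

lemma vertex_pairs_disjoint: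
  assumes "A \<inter> B = {}"
  shows "vertex_pairs A \<inter> vertex_pairs B = {}"
  using assms unfolding vertex_pairs_def by (auto simp: card_2_iff)

lemma joined_refl [simp]: "(u, u) \<in> joined E"
  by (simp add: joined_def)

lemma joined_sym: "(u, v) \<in> joined E \<Longrightarrow> (v, u) \<in> joined E"
proof -
  have "sym {(u, v). {u, v} \<in> E}"
    by (auto intro: symI simp: insert_commute)
  then show "(u, v) \<in> joined E \<Longrightarrow> (v, u) \<in> joined E"
    unfolding joined_def by (metis sym_rtrancl symD)
qed

lemma joined_trans: "(u, v) \<in> joined E \<Longrightarrow> (v, w) \<in> joined E \<Longrightarrow> (u, w) \<in> joined E"
  by (simp add: joined_def)

lemma joined_edge: "{u, v} \<in> E \<Longrightarrow> (u, v) \<in> joined E"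
  by (auto simp: joined_def)

lemma joined_mono: "E \<subseteq> F \<Longrightarrow> joined E \<subseteq> joined F"
  unfolding joined_def by (rule rtrancl_mono) auto

lemma joined_empty: "joined {} = Id"
  by (simp add: joined_def)

text \<open>A path can be shortened until it crosses the new edge at most once, in one of two
  directions. The two arcs of the edge are added one after the other by
  \<open>rtrancl_insert\<close>.\<close>

lemma joined_insert:
  "(x, y) \<in> joined (insert {u, v} E) \<longleftrightarrow>
     (x, y) \<in> joined E \<or> (x, u) \<in> joined E \<and> (v, y) \<in> joined E \<or>
     (x, v) \<in> joined E \<and> (u, y) \<in> joined E"
proof -
  have "{(x, y). {x, y} \<in> insert {u, v} E} = insert (u, v) (insert (v, u) {(x, y). {x, y} \<in> E})"
    by (auto simp: doubleton_eq_iff)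
  then have "joined (insert {u, v} E) = (insert (u, v) (insert (v, u) {(x, y). {x, y} \<in> E}))\<^sup>*"
    by (simp add: joined_def)
  then show ?thesis
    using joined_trans[of _ _ E] joined_refl[of _ E]
    by (simp add: rtrancl_insert flip: joined_def) meson
qed

lemma joined_closed:
  assumes "E \<subseteq> vertex_pairs V" "(u, v) \<in> joined E" "u \<in> V"
  shows "v \<in> V"
  using assms(2,3) unfolding joined_def
proof (induction rule: rtrancl_induct)
  case (step v w)
  then have "{v, w} \<in> vertex_pairs V" using assms(1) by auto
  then show ?case by (simp add: mem_vertex_pairs)
qed

lemma mem_class_of: "v \<in> class_of E u \<longleftrightarrow> (u, v) \<in> joined E"
  by (simp add: class_of_def)

lemma class_of_self [simp]: "u \<in> class_of E u"
  by (simp add: mem_class_of)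

lemma class_of_eq_iff: "class_of E u = class_of E v \<longleftrightarrow> (u, v) \<in> joined E"
proof
  assume "class_of E u = class_of E v"
  moreover have "(v, v) \<in> joined E" by simp
  ultimately show "(u, v) \<in> joined E" by (simp flip: mem_class_of)
next
  assume "(u, v) \<in> joined E"
  then show "class_of E u = class_of E v"
    unfolding set_eq_iff mem_class_of using joined_sym joined_trans by metis
qed

lemma class_of_subset: "E \<subseteq> vertex_pairs V \<Longrightarrow> u \<in> V \<Longrightarrow> class_of E u \<subseteq> V"
  using joined_closed by (auto simp: mem_class_of)

lemma classes_subset: "E \<subseteq> vertex_pairs V \<Longrightarrow> C \<in> classes V E \<Longrightarrow> C \<subseteq> V"
  unfolding classes_def by (elim imageE) (simp add: class_of_subset)

lemma classes_nonempty: "C \<in> classes V E \<Longrightarrow> C \<noteq> {}"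
  unfolding classes_def by (elim imageE) (metis class_of_self empty_iff)

lemma finite_classes [simp]: "finite V \<Longrightarrow> finite (classes V E)"
  by (simp add: classes_def)

lemma class_of_eq: "C \<in> classes V E \<Longrightarrow> u \<in> C \<Longrightarrow> class_of E u = C"
  unfolding classes_def by (metis (no_types) class_of_eq_iff imageE mem_class_of)

lemma classes_disjoint:
  assumes "C \<in> classes V E" "D \<in> classes V E" "C \<noteq> D"
  shows "C \<inter> D = {}"
  using assms by (metis class_of_eq disjoint_iff)

lemma Union_classes: "E \<subseteq> vertex_pairs V \<Longrightarrow> \<Union> (classes V E) = V"
  using class_of_subset[of E V] unfolding classes_def by fastforce

lemma classes_empty: "classes V {} = (\<lambda>v. {v}) ` V"
proof -
  have "class_of {} = (\<lambda>v. {v :: 'a})"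
    by (rule ext) (simp add: class_of_def joined_empty)
  then show ?thesis by (simp add: classes_def)
qed

section \<open>Effect of one additional edge on the classes\<close>

lemma class_of_insert:
  assumes "(u, v) \<notin> joined E"
  shows "class_of (insert {u, v} E) x =
    (if x \<in> class_of E u \<union> class_of E v then class_of E u \<union> class_of E v else class_of E x)"
proof -
  have "x \<in> class_of E w \<longleftrightarrow> (x, w) \<in> joined E" for w
    using joined_sym mem_class_of by metis
  moreover have "class_of (insert {u, v} E) x = class_of E x \<union>
      (if (x, u) \<in> joined E then class_of E v else {}) \<union>
      (if (x, v) \<in> joined E then class_of E u else {})"
    by (auto simp: mem_class_of joined_insert)
  moreover have "\<not> ((x, u) \<in> joined E \<and> (x, v) \<in> joined E)"
    using assms joined_sym joined_trans by metis
  moreover have "(x, u) \<in> joined E \<Longrightarrow> class_of E x = class_of E u"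
    "(x, v) \<in> joined E \<Longrightarrow> class_of E x = class_of E v"
    by (simp_all add: class_of_eq_iff)
  ultimately show ?thesis by (simp add: Un_commute)
qed

lemma classes_insert_joined:
  assumes "(u, v) \<in> joined E"
  shows "classes V (insert {u, v} E) = classes V E"
proof -
  have "(x, y) \<in> joined (insert {u, v} E) \<longleftrightarrow> (x, y) \<in> joined E" for x y
    unfolding joined_insert using assms joined_sym joined_trans by metis
  then have "joined (insert {u, v} E) = joined E" by auto
  then show ?thesis by (simp add: classes_def class_of_def)
qed

lemma classes_insert:
  assumes "E \<subseteq> vertex_pairs V" "u \<in> V" "v \<in> V" "(u, v) \<notin> joined E"
  shows "classes V (insert {u, v} E) =
    insert (class_of E u \<union> class_of E v) (classes V E - {class_of E u, class_of E v})"
proof -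
  let ?a = "class_of E u" and ?b = "class_of E v"
  have iff: "x \<in> ?a \<union> ?b \<longleftrightarrow> class_of E x \<in> {?a, ?b}" for x
    unfolding insert_iff empty_iff class_of_eq_iff Un_iff mem_class_of
    using joined_sym by metis
  have ab: "?a \<in> classes V E" "?b \<in> classes V E"
    using assms by (simp_all add: classes_def)
  have "classes V (insert {u, v} E) =
      (\<lambda>C. if C \<in> {?a, ?b} then ?a \<union> ?b else C) ` classes V E"
    unfolding classes_def image_image class_of_insert[OF assms(4)] iff ..
  also have "\<dots> = insert (?a \<union> ?b) (classes V E - {?a, ?b})"
    using ab by auto
  finally show ?thesis .
qed

text \<open>These are the side conditions for evaluating a cardinality or a product over the classes
  after a merge: two distinct old classes disappear, and their union is really new.\<close>

lemma classes_merge: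
  assumes "E \<subseteq> vertex_pairs V" "u \<in> V" "v \<in> V" "(u, v) \<notin> joined E"
  shows "class_of E u \<in> classes V E" "class_of E v \<in> classes V E"
    "class_of E u \<noteq> class_of E v" "class_of E u \<inter> class_of E v = {}"
    "class_of E u \<union> class_of E v \<notin> classes V E"
proof -
  show *: "class_of E u \<in> classes V E" "class_of E v \<in> classes V E" "class_of E u \<noteq> class_of E v"
    using assms by (auto simp: classes_def class_of_eq_iff)
  then show "class_of E u \<inter> class_of E v = {}" by (intro classes_disjoint)
  show "class_of E u \<union> class_of E v \<notin> classes V E"
    by (metis assms(4) class_of_eq class_of_self mem_class_of Un_iff)
qed

lemma card_classes_insert:
  assumes "finite V" "E \<subseteq> vertex_pairs V" "u \<in> V" "v \<in> V" "(u, v) \<notin> joined E"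
  shows "Suc (card (classes V (insert {u, v} E))) = card (classes V E)"
proof -
  note m = classes_merge[OF assms(2-)]
  have "card (classes V E - {class_of E u, class_of E v}) = card (classes V E) - 2"
    using m by (subst card_Diff_subset) auto
  moreover have "2 \<le> card (classes V E)"
    using card_mono[of "classes V E" "{class_of E u, class_of E v}"] m assms(1) by auto
  ultimately show ?thesis
    using m assms(1) by (subst classes_insert[OF assms(2-)]) (subst card_insert_disjoint, auto)
qed

text \<open>Without edges there are \<open>card V\<close> singleton classes, and each edge lowers
  their number by at most one.\<close>

lemma card_classes_ge:
  assumes "finite V" "E \<subseteq> vertex_pairs V"
  shows "card V \<le> card (classes V E) + card E"
proof -
  have "finite E" using assms finite_vertex_pairs finite_subset by blast
  then show ?thesis using assms(2)
  proof induction
    case empty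
    show ?case by (simp add: classes_empty card_image)
  next
    case (insert e E)
    then obtain u v where e: "e = {u, v}" "u \<in> V" "v \<in> V" by (auto elim: vertex_pairsE)
    show ?case
      using insert e card_classes_insert[OF assms(1), of E u v] classes_insert_joined[of u v E V]
      by (cases "(u, v) \<in> joined E") auto
  qed
qed

lemma classes_eq_singleton_iff:
  assumes "E \<subseteq> vertex_pairs V" "finite V"
  shows "classes V E = {V} \<longleftrightarrow> card (classes V E) = 1"
proof
  assume "card (classes V E) = 1"
  then obtain C where "classes V E = {C}" by (auto simp: card_1_singleton_iff)
  with Union_classes[OF assms(1)] show "classes V E = {V}" by auto
qed simp

section \<open>Forests weighted by their rootings\<close>

text \<open>
  The classes always number at least \<open>card V - card E\<close>, and an edge can be removed without
  splitting a class iff it lies on a cycle: equality characterises the acyclic graphs.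
\<close>

definition forests :: "'a set \<Rightarrow> nat \<Rightarrow> 'a set set set" where
  "forests V j = {E. E \<subseteq> vertex_pairs V \<and> card E = j \<and> card (classes V E) + j = card V}"

text \<open>For a forest, this is the number of ways to choose a root in each tree.\<close>

definition rootings :: "'a set \<Rightarrow> 'a set set \<Rightarrow> real" where
  "rootings V E = (\<Prod>C\<in>classes V E. real (card C))"

lemma finite_forests: "finite V \<Longrightarrow> finite (forests V j)"
  by (rule finite_subset[of _ "Pow (vertex_pairs V)"]) (auto simp: forests_def finite_vertex_pairs)

text \<open>An edge inside a class leaves the number of classes unchanged, so the defining equation
  for \<open>Suc j\<close> edges would leave \<open>E\<close> with one class fewer than
  \<open>card_classes_ge\<close> permits.\<close>

lemma forests_insert_iff:
  assumes "finite V" "E \<subseteq> vertex_pairs V" "{u, v} \<in> vertex_pairs V" "{u, v} \<notin> E"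
  shows "insert {u, v} E \<in> forests V (Suc j) \<longleftrightarrow> E \<in> forests V j \<and> (u, v) \<notin> joined E"
proof -
  have fin: "finite E" using assms finite_vertex_pairs finite_subset by blast
  have uv: "u \<in> V" "v \<in> V" using assms by (auto simp: mem_vertex_pairs)
  show ?thesis
    using card_classes_insert[OF assms(1,2) uv] classes_insert_joined[of u v E V]
      card_classes_ge[OF assms(1,2)] assms fin
    by (cases "(u, v) \<in> joined E") (auto simp: forests_def)
qed

text \<open>Merging classes of sizes \<open>a\<close> and \<open>b\<close> replaces the factor
  \<open>a * b\<close> by \<open>a + b\<close>, which is \<open>a * b * (1 / a + 1 / b)\<close>. The
  reciprocals are what makes summation over all admissible pairs easy.\<close>

lemma rootings_insert:
  assumes "finite V" "E \<subseteq> vertex_pairs V" "u \<in> V" "v \<in> V" "(u, v) \<notin> joined E"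
  shows "rootings V (insert {u, v} E) =
    rootings V E * (1 / card (class_of E u) + 1 / card (class_of E v))"
proof -
  note m = classes_merge[OF assms(2-)]
  have fin: "finite (class_of E u)" "finite (class_of E v)"
    using assms class_of_subset finite_subset by metis+
  have pos: "card (class_of E u) > 0" "card (class_of E v) > 0"
    using fin class_of_self by (metis card_gt_0_iff empty_iff)+
  let ?R = "classes V E - {class_of E u, class_of E v}"
  have "rootings V E = (\<Prod>C\<in>insert (class_of E u) (insert (class_of E v) ?R). real (card C))"
    unfolding rootings_def using m by (intro prod.cong) auto
  also have "\<dots> = card (class_of E u) * card (class_of E v) * (\<Prod>C\<in>?R. real (card C))"
    using m assms(1) by (simp add: mult_ac)
  finally have 1: "rootings V E = \<dots>" .
  have "rootings V (insert {u, v} E) =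
      card (class_of E u \<union> class_of E v) * (\<Prod>C\<in>?R. real (card C))"
    unfolding rootings_def using m assms(1) by (simp add: classes_insert[OF assms(2-)])
  also have "card (class_of E u \<union> class_of E v) = card (class_of E u) + card (class_of E v)"
    using m fin by (simp add: card_Un_disjoint)
  finally show ?thesis using pos unfolding 1 by (simp add: field_simps)
qed

text \<open>The members of a class share the value \<open>1 / card C\<close>, so every class
  contributes exactly 1.\<close>

lemma sum_inverse_class_size:
  assumes "finite V" "E \<subseteq> vertex_pairs V"
  shows "(\<Sum>v\<in>V. 1 / real (card (class_of E v))) = card (classes V E)"
    and "u \<in> V \<Longrightarrow> (\<Sum>v\<in>class_of E u. 1 / real (card (class_of E v))) = 1"
proof -
  have *: "(\<Sum>v\<in>C. 1 / real (card (class_of E v))) = 1" if "C \<in> classes V E" for C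
  proof -
    have "finite C" "C \<noteq> {}"
      using that classes_subset[OF assms(2)] assms(1) finite_subset classes_nonempty by metis+
    then show ?thesis using that by (simp add: class_of_eq)
  qed
  then show "u \<in> V \<Longrightarrow> (\<Sum>v\<in>class_of E u. 1 / real (card (class_of E v))) = 1"
    by (simp add: classes_def)
  have "\<forall>C\<in>classes V E. finite C"
    using classes_subset[OF assms(2)] assms(1) finite_subset by metis
  moreover have "\<forall>C\<in>classes V E. \<forall>D\<in>classes V E. C \<noteq> D \<longrightarrow> C \<inter> D = {}"
    using classes_disjoint by metis
  ultimately have "(\<Sum>v\<in>\<Union> (classes V E). 1 / real (card (class_of E v))) =
      (\<Sum>C\<in>classes V E. \<Sum>v\<in>C. 1 / real (card (class_of E v)))"
    using sum.Union_disjoint by (metis comp_apply)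
  then show "(\<Sum>v\<in>V. 1 / real (card (class_of E v))) = card (classes V E)"
    using * Union_classes[OF assms(2)] by simp
qed

text \<open>For fixed \<open>u\<close>, summing the reciprocal class size of \<open>v\<close> over
  all \<open>v\<close> outside the class of \<open>u\<close> counts the other classes, of which a
  forest with \<open>j\<close> edges has \<open>card V - j - 1\<close>. Swapping \<open>u\<close>
  and \<open>v\<close> gives the same sum again, hence the 2. The resulting factor depends on
  \<open>E\<close> only through \<open>j\<close>.\<close>

lemma sum_rootings_insert:
  assumes "finite V" "E \<in> forests V j"
  shows "(\<Sum>(u, v) | u \<in> V \<and> v \<in> V \<and> (u, v) \<notin> joined E. rootings V (insert {u, v} E)) =
    rootings V E * (2 * card V * (real (card V) - j - 1))"
proof -
  have E: "E \<subseteq> vertex_pairs V" "card (classes V E) + j = card V"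
    using assms by (auto simp: forests_def)
  define f where "f u = 1 / real (card (class_of E u))" for u
  define D where "D = {(u, v). u \<in> V \<and> v \<in> V \<and> (u, v) \<notin> joined E}"
  have D: "D = Sigma V (\<lambda>u. V - class_of E u)"
    by (auto simp: D_def mem_class_of)
  have snd: "(\<Sum>(u, v)\<in>D. f v) = card V * (real (card V) - j - 1)"
  proof -
    have "(\<Sum>(u, v)\<in>D. f v) = (\<Sum>u\<in>V. \<Sum>v\<in>V - class_of E u. f v)"
      unfolding D using assms(1) by (subst sum.Sigma) auto
    also have "\<dots> = (\<Sum>u\<in>V. real (card (classes V E)) - 1)"
    proof (rule sum.cong)
      fix u assume "u \<in> V"
      then show "(\<Sum>v\<in>V - class_of E u. f v) = real (card (classes V E)) - 1"
        using assms(1) E(1) class_of_subset[OF E(1)]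
        by (simp add: sum_diff f_def sum_inverse_class_size)
    qed simp
    moreover have "real (card (classes V E)) = real (card V) - j"
      using E(2) by linarith
    ultimately show ?thesis by simp
  qed
  have fst: "(\<Sum>(u, v)\<in>D. f u) = (\<Sum>(u, v)\<in>D. f v)"
    by (rule sum.reindex_bij_witness[of _ prod.swap prod.swap])
       (auto simp: D_def dest: joined_sym)
  have "(\<Sum>(u, v)\<in>D. rootings V (insert {u, v} E)) = (\<Sum>(u, v)\<in>D. rootings V E * (f u + f v))"
    by (rule sum.cong) (auto simp: D_def f_def rootings_insert[OF assms(1) E(1)])
  also have "\<dots> = rootings V E * ((\<Sum>(u, v)\<in>D. f u) + (\<Sum>(u, v)\<in>D. f v))"
    by (simp add: sum_distrib_left sum.distrib split_def algebra_simps)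
  finally have "(\<Sum>(u, v)\<in>D. rootings V (insert {u, v} E)) = \<dots>" .
  then show ?thesis unfolding fst snd by (simp add: D_def)
qed

lemma card_ordered_edges:
  assumes "finite V" "E \<subseteq> vertex_pairs V"
  shows "card {(u, v). {u, v} \<in> E} = 2 * card E"
proof -
  have fin: "finite E" using assms finite_vertex_pairs finite_subset by blast
  have two: "finite {(u, v). {u, v} = e} \<and> card {(u, v). {u, v} = e} = 2" if "e \<in> E" for e
  proof -
    obtain a b where "e = {a, b}" "a \<noteq> b"
      using \<open>e \<in> E\<close> assms(2) by (blast elim: vertex_pairsE)
    then have "{(u, v). {u, v} = e} = {(a, b), (b, a)}" by (auto simp: doubleton_eq_iff)
    then show ?thesis using \<open>a \<noteq> b\<close> by simp
  qed
  have "{(u, v). {u, v} \<in> E} = (\<Union>e\<in>E. {(u, v). {u, v} = e})" by auto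
  moreover have "card (\<Union>e\<in>E. {(u, v). {u, v} = e}) = (\<Sum>e\<in>E. card {(u, v). {u, v} = e})"
    by (rule card_UN_disjoint) (use fin two in auto)
  ultimately show ?thesis using two by simp
qed

text \<open>
  Both sides count, weighted by rootings and up to a factor 2, the pairs of a forest with
  \<open>j + 1\<close> edges and an orientation of one of its edges, the right-hand side via the forest
  without that edge.
\<close>

lemma sum_rootings_Suc:
  assumes "finite V"
  shows "Suc j * (\<Sum>E\<in>forests V (Suc j). rootings V E) =
    card V * (real (card V) - j - 1) * (\<Sum>E\<in>forests V j. rootings V E)"
proof -
  let ?A = "SIGMA E:forests V j. {(u, v). u \<in> V \<and> v \<in> V \<and> (u, v) \<notin> joined E}"
  let ?B = "SIGMA E:forests V (Suc j). {(u, v). {u, v} \<in> E}"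
  have finA: "finite {(u, v). u \<in> V \<and> v \<in> V \<and> (u, v) \<notin> joined E}" for E
    by (rule finite_subset[of _ "V \<times> V"]) (use assms in auto)
  have finB: "finite {(u, v). {u, v} \<in> E}" if "E \<in> forests V (Suc j)" for E
  proof (rule finite_subset[of _ "V \<times> V"])
    have "E \<subseteq> vertex_pairs V" using that by (simp add: forests_def)
    then have "u \<in> V \<and> v \<in> V" if "{u, v} \<in> E" for u v
      using that mem_vertex_pairs[of u v V] by blast
    then show "{(u, v). {u, v} \<in> E} \<subseteq> V \<times> V" by auto
  qed (use assms in simp)
  have "(\<Sum>E\<in>forests V j. \<Sum>(u, v) | u \<in> V \<and> v \<in> V \<and> (u, v) \<notin> joined E.
          rootings V (insert {u, v} E)) = (\<Sum>(E, u, v)\<in>?A. rootings V (insert {u, v} E))"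
    using assms finA by (subst sum.Sigma) (auto simp: finite_forests)
  also have "\<dots> = (\<Sum>(E, u, v)\<in>?B. rootings V E)"
  proof (rule sum.reindex_bij_witness[of _ "\<lambda>(E, u, v). (E - {{u, v}}, u, v)"
        "\<lambda>(E, u, v). (insert {u, v} E, u, v)"], goal_cases)
    case (1 a)
    then obtain E u v where a: "a = (E, u, v)" "(u, v) \<notin> joined E" by auto
    then have "{u, v} \<notin> E" using joined_edge by metis
    then show ?case using a by simp
  next
    case (2 a)
    then obtain E u v where a: "a = (E, u, v)" "E \<in> forests V j" "u \<in> V" "v \<in> V" "(u, v) \<notin> joined E"
      by auto
    then have "{u, v} \<notin> E" "{u, v} \<in> vertex_pairs V" "E \<subseteq> vertex_pairs V"
      using joined_edge[of u v E] joined_refl[of u E] by (auto simp: mem_vertex_pairs forests_def)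
    then have "insert {u, v} E \<in> forests V (Suc j)"
      using a assms by (simp add: forests_insert_iff)
    then show ?case using a by simp
  next
    case (3 b)
    then show ?case by (auto simp: insert_absorb)
  next
    case (4 b)
    then obtain E u v where b: "b = (E, u, v)" "E \<in> forests V (Suc j)" "{u, v} \<in> E"
      by auto
    have "E \<subseteq> vertex_pairs V" using b by (simp add: forests_def)
    moreover from this have uv: "{u, v} \<in> vertex_pairs V" using b by blast
    moreover have "insert {u, v} (E - {{u, v}}) = E" using b by blast
    ultimately have "E - {{u, v}} \<in> forests V j \<and> (u, v) \<notin> joined (E - {{u, v}})"
      using b assms by (subst forests_insert_iff[symmetric]) (simp_all, blast)
    then show ?case using b uv by (simp add: mem_vertex_pairs)
  next
    case (5 a)
    then show ?case by (simp add: split_def)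
  qed
  also have "\<dots> = (\<Sum>E\<in>forests V (Suc j). \<Sum>(u, v) | {u, v} \<in> E. rootings V E)"
    using assms finB by (subst sum.Sigma) (auto simp: finite_forests)
  also have "\<dots> = (\<Sum>E\<in>forests V (Suc j). 2 * Suc j * rootings V E)"
  proof (rule sum.cong)
    fix E assume "E \<in> forests V (Suc j)"
    then show "(\<Sum>(u, v) | {u, v} \<in> E. rootings V E) = 2 * Suc j * rootings V E"
      using card_ordered_edges[OF assms, of E] by (simp add: split_def forests_def)
  qed simp
  finally have "(\<Sum>E\<in>forests V j. \<Sum>(u, v) | u \<in> V \<and> v \<in> V \<and> (u, v) \<notin> joined E.
      rootings V (insert {u, v} E)) = 2 * Suc j * (\<Sum>E\<in>forests V (Suc j). rootings V E)"
    by (simp only: sum_distrib_left)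
  moreover have "(\<Sum>E\<in>forests V j. \<Sum>(u, v) | u \<in> V \<and> v \<in> V \<and> (u, v) \<notin> joined E.
      rootings V (insert {u, v} E)) =
      (\<Sum>E\<in>forests V j. rootings V E) * (2 * card V * (real (card V) - j - 1))"
    using sum_rootings_insert[OF assms] by (simp add: sum_distrib_right)
  ultimately have "2 * Suc j * (\<Sum>E\<in>forests V (Suc j). rootings V E) =
      (\<Sum>E\<in>forests V j. rootings V E) * (2 * card V * (real (card V) - j - 1))"
    by argo
  then show ?thesis by (simp add: algebra_simps)
qed

text \<open>Iterating \<open>sum_rootings_Suc\<close> from the empty forest, which has weight 1,
  multiplies by \<open>card V * (card V - 1 - i) / (i + 1)\<close> for each \<open>i < j\<close>.
  For \<open>j = card V - 1\<close> this is the number of rooted trees.\<close>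

lemma sum_rootings:
  assumes "finite V" "j < card V"
  shows "(\<Sum>E\<in>forests V j. rootings V E) = ((card V - 1) choose j) * card V ^ j"
  using assms(2)
proof (induction j)
  case 0
  have "forests V 0 = {{}}"
    using assms by (auto simp: forests_def classes_empty card_image dest: finite_subset[OF _ finite_vertex_pairs])
  moreover have "rootings V {} = 1"
    unfolding rootings_def classes_empty by (intro prod.neutral) auto
  ultimately show ?case by simp
next
  case (Suc j)
  let ?n = "card V"
  have "Suc j * ((?n - 1) choose Suc j) = (?n - 1 - j) * ((?n - 1) choose j)"
    by (metis binomial_absorption binomial_absorb_comp)
  then have "real (Suc j) * ((?n - 1) choose Suc j) = real (?n - 1 - j) * ((?n - 1) choose j)"
    by (metis of_nat_mult)
  moreover have "real (?n - 1 - j) = real ?n - j - 1" using Suc.prems by linarith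
  ultimately have "Suc j * real ((?n - 1) choose Suc j) = (real ?n - j - 1) * ((?n - 1) choose j)"
    by simp
  moreover have "Suc j * (\<Sum>E\<in>forests V (Suc j). rootings V E) =
      ?n * (real ?n - j - 1) * (((?n - 1) choose j) * ?n ^ j)"
    using sum_rootings_Suc[OF assms(1), of j] Suc by simp
  ultimately have "Suc j * (\<Sum>E\<in>forests V (Suc j). rootings V E) =
      ?n * ?n ^ j * (Suc j * real ((?n - 1) choose Suc j))"
    by (simp only: mult_ac of_nat_mult)
  then have "Suc j * (\<Sum>E\<in>forests V (Suc j). rootings V E) =
      Suc j * (real ((?n - 1) choose Suc j) * ?n ^ Suc j)"
    by (simp only: mult_ac power_Suc of_nat_mult)
  then show ?case by (simp only: mult_cancel_left of_nat_mult) simp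
qed

section \<open>Connected graphs on a given vertex set\<close>

definition connected_graphs :: "'a set \<Rightarrow> nat \<Rightarrow> 'a set set set" where
  "connected_graphs S j = {E. E \<subseteq> vertex_pairs S \<and> card E = j \<and> classes S E = {S}}"

lemma finite_connected_graphs: "finite S \<Longrightarrow> finite (connected_graphs S j)"
  by (rule finite_subset[of _ "Pow (vertex_pairs S)"])
     (auto simp: connected_graphs_def finite_vertex_pairs)

lemma connected_graphs_few_edges:
  assumes "finite S" "Suc j < card S"
  shows "connected_graphs S j = {}"
proof -
  have "card S \<le> Suc j" if "E \<in> connected_graphs S j" for E
    using card_classes_ge[OF assms(1), of E] that by (simp add: connected_graphs_def)
  then show ?thesis using assms(2) by fastforce
qed

lemma connected_graphs_many_edges:
  assumes "finite S" "card S choose 2 < j"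
  shows "connected_graphs S j = {}"
proof -
  have "j \<le> card S choose 2" if "E \<in> connected_graphs S j" for E
    using that card_mono[OF finite_vertex_pairs[OF assms(1)], of E]
    by (simp add: connected_graphs_def card_vertex_pairs assms(1))
  then show ?thesis using assms(2) by fastforce
qed

text \<open>A forest with \<open>card S - 1\<close> edges has a single class and hence
  \<open>card S\<close> rootings, so the number of rooted trees is divided by \<open>card S\<close>.
  The exponent is an integer because it is -1 for a single vertex, where the value is still
  1.\<close>

theorem Cayley_formula:
  assumes "finite S" "S \<noteq> {}"
  shows "real (card (connected_graphs S (card S - 1))) = card S powi (int (card S) - 2)"
proof -
  let ?n = "card S"
  have pos: "?n > 0" using assms by (simp add: card_gt_0_iff)
  have "forests S (?n - 1) = connected_graphs S (?n - 1)"
    unfolding forests_def connected_graphs_def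
    using pos by (intro Collect_cong conj_cong refl) (simp add: classes_eq_singleton_iff[OF _ assms(1)], linarith)
  moreover have "rootings S E = ?n" if "E \<in> connected_graphs S (?n - 1)" for E
    using that by (simp add: rootings_def connected_graphs_def)
  ultimately have "card (connected_graphs S (?n - 1)) * real ?n = real ?n ^ (?n - 1)"
    using sum_rootings[OF assms(1), of "?n - 1"] pos by simp
  also have "real ?n ^ (?n - 1) = real ?n powi (int ?n - 2) * ?n"
  proof -
    have "real ?n powi (int ?n - 2) * real ?n = real ?n powi (int ?n - 1)"
      using power_int_add[of "real ?n" "int ?n - 2" 1] pos by simp
    also have "int ?n - 1 = int (?n - 1)" using pos by linarith
    finally show ?thesis by (simp only: power_int_of_nat)
  qed
  finally show ?thesis using pos by simp
qed

section \<open>Counting graphs with prescribed classes\<close>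

lemma classes_eq_singleton_iff_joined:
  assumes "E \<subseteq> vertex_pairs S"
  shows "classes S E = {S} \<longleftrightarrow> S \<noteq> {} \<and> (\<forall>u\<in>S. \<forall>v\<in>S. (u, v) \<in> joined E)"
proof
  assume *: "classes S E = {S}"
  then have "class_of E u = S" if "u \<in> S" for u
    using that unfolding classes_def by blast
  with * show "S \<noteq> {} \<and> (\<forall>u\<in>S. \<forall>v\<in>S. (u, v) \<in> joined E)"
    by (auto simp: classes_def simp flip: mem_class_of)
next
  assume *: "S \<noteq> {} \<and> (\<forall>u\<in>S. \<forall>v\<in>S. (u, v) \<in> joined E)"
  then have "class_of E u = S" if "u \<in> S" for u
    using that class_of_subset[OF assms that] by (auto simp: mem_class_of)
  with * show "classes S E = {S}" by (auto simp: classes_def)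
qed

lemma joined_image:
  assumes "(u, v) \<in> joined E"
  shows "(f u, f v) \<in> joined ((`) f ` E)"
  using assms unfolding joined_def
proof (induction rule: rtrancl_induct)
  case (step v w)
  then have "f ` {v, w} \<in> (`) f ` E" by blast
  then have "(f v, f w) \<in> {(u, v). {u, v} \<in> (`) f ` E}" by simp
  with step.IH show ?case by (rule rtrancl_into_rtrancl)
qed simp

text \<open>Renaming the vertices by \<open>f\<close> is injective on edge sets over
  \<open>S\<close>, and paths are mapped to paths. The inequality suffices, since it can be used for
  the inverse bijection too.\<close>

lemma card_connected_graphs_le:
  assumes "finite T" "bij_betw f S T"
  shows "card (connected_graphs S j) \<le> card (connected_graphs T j)"
proof (rule card_inj_on_le)
  have f: "inj_on f S" "f ` S = T" using assms(2) by (simp_all add: bij_betw_def)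
  have inj: "inj_on ((`) ((`) f)) (Pow (Pow S))"
    by (intro inj_on_image_Pow f)
  have sub: "E \<subseteq> Pow S" if "E \<in> connected_graphs S j" for E
    using that by (auto simp: connected_graphs_def vertex_pairs_def)
  show "inj_on ((`) ((`) f)) (connected_graphs S j)"
    using sub by (intro inj_on_subset[OF inj]) auto
  show "finite (connected_graphs T j)" by (rule finite_connected_graphs) fact
  show "(`) ((`) f) ` connected_graphs S j \<subseteq> connected_graphs T j"
  proof (rule image_subsetI)
    fix E assume E: "E \<in> connected_graphs S j"
    have "f ` e \<in> vertex_pairs T" if "e \<in> E" for e
    proof -
      have "e \<subseteq> S" "card e = 2" using that E by (auto simp: connected_graphs_def vertex_pairs_def)
      then show ?thesis
        using f inj_on_subset[OF f(1)] by (auto simp: vertex_pairs_def card_image)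
    qed
    then have pairs: "(`) f ` E \<subseteq> vertex_pairs T" by auto
    moreover have "card ((`) f ` E) = j"
      using inj_on_subset[OF inj_on_image_Pow[OF f(1)] sub[OF E]] E
      by (simp add: card_image connected_graphs_def)
    moreover have "classes T ((`) f ` E) = {T}"
      using E f(2) joined_image[of _ _ E f]
      by (auto simp: connected_graphs_def classes_eq_singleton_iff_joined[OF pairs]
          classes_eq_singleton_iff_joined)
    ultimately show "(`) f ` E \<in> connected_graphs T j"
      by (simp add: connected_graphs_def)
  qed
qed

definition num_connected :: "nat \<Rightarrow> nat \<Rightarrow> nat" where
  "num_connected k j = card (connected_graphs {..<k} j)"

lemma card_connected_graphs:
  assumes "finite S"
  shows "card (connected_graphs S j) = num_connected (card S) j"
proof -
  obtain f where "bij_betw f S {..<card S}"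
    using ex_bij_betw_finite_nat[OF assms] by (auto simp: atLeast0LessThan)
  then show ?thesis unfolding num_connected_def
    using card_connected_graphs_le[OF _ \<open>bij_betw f S {..<card S}\<close>]
      card_connected_graphs_le[OF assms bij_betw_inv_into]
    by (intro antisym) auto
qed

lemma num_connected_few_edges: "Suc j < k \<Longrightarrow> num_connected k j = 0"
  by (simp add: num_connected_def connected_graphs_few_edges)

lemma num_connected_many_edges: "k choose 2 < j \<Longrightarrow> num_connected k j = 0"
  by (simp add: num_connected_def connected_graphs_many_edges)

lemma num_connected_tree:
  assumes "k > 0"
  shows "real (num_connected k (k - 1)) = real k powi (int k - 2)"
  using Cayley_formula[of "{..<k}"] assms by (auto simp: num_connected_def lessThan_empty_iff)

section \<open>Splitting a graph along one of its classes\<close>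

lemma class_of_Un:
  assumes "E \<subseteq> vertex_pairs A" "F \<subseteq> vertex_pairs B" "A \<inter> B = {}" "x \<in> A"
  shows "class_of (E \<union> F) x = class_of E x"
proof -
  have "(x, y) \<in> joined E" if "(x, y) \<in> joined (E \<union> F)" for y
    using that unfolding joined_def[of "E \<union> F"]
  proof (induction rule: rtrancl_induct)
    case (step y z)
    have "y \<in> A" using joined_closed[OF assms(1) step.IH assms(4)] .
    \<comment> \<open>A path that starts in \<open>A\<close> stays in \<open>A\<close> and so never
      meets an end of an edge from \<open>F\<close>.\<close>
    then have "{y, z} \<notin> vertex_pairs B" using assms(3) by (auto simp: mem_vertex_pairs)
    then have "{y, z} \<in> E" using step.hyps assms(2) by auto
    then show ?case using joined_trans[OF step.IH joined_edge] by blast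
  qed simp
  then show ?thesis
    using joined_mono[of E "E \<union> F"] by (auto simp: mem_class_of)
qed

lemma classes_Un:
  assumes "E \<subseteq> vertex_pairs A" "F \<subseteq> vertex_pairs B" "A \<inter> B = {}"
  shows "classes (A \<union> B) (E \<union> F) = classes A E \<union> classes B F"
proof -
  have "class_of (E \<union> F) ` A = class_of E ` A"
    using class_of_Un[OF assms] by (rule image_cong[OF refl])
  moreover have "class_of (E \<union> F) ` B = class_of F ` B"
    using class_of_Un[OF assms(2,1)] assms(3)
    by (intro image_cong[OF refl]) (simp add: Un_commute Int_commute)
  ultimately show ?thesis by (simp add: classes_def image_Un)
qed

lemma mem_classes_Un_iff:
  assumes "E \<subseteq> vertex_pairs S" "F \<subseteq> vertex_pairs (V - S)" "S \<subseteq> V"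
  shows "S \<in> classes V (E \<union> F) \<longleftrightarrow> classes S E = {S}"
proof -
  have "classes V (E \<union> F) = classes S E \<union> classes (V - S) F"
    using classes_Un[OF assms(1,2)] assms(3) by (simp add: Un_absorb1)
  moreover have "S \<notin> classes (V - S) F"
    using classes_subset[OF assms(2)] classes_nonempty by blast
  moreover have "classes S E = {S}" if "S \<in> classes S E"
  proof -
    have "C = S" if "C \<in> classes S E" for C
      using classes_disjoint[OF that \<open>S \<in> classes S E\<close>] classes_nonempty[OF that]
        classes_subset[OF assms(1) that] by auto
    with that show ?thesis by auto
  qed
  ultimately show ?thesis by auto
qed

text \<open>The two ends of an edge lie in the same class, so no edge leads out of
  \<open>S\<close>.\<close>

lemma edges_split:
  assumes "E \<subseteq> vertex_pairs V" "S \<in> classes V E"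
  shows "(E \<inter> vertex_pairs S) \<union> (E \<inter> vertex_pairs (V - S)) = E"
proof -
  have "e \<in> vertex_pairs S \<union> vertex_pairs (V - S)" if "e \<in> E" for e
  proof -
    obtain u v where e: "e = {u, v}" "u \<in> V" "v \<in> V" "u \<noteq> v"
      using subsetD[OF assms(1) \<open>e \<in> E\<close>] by (elim vertex_pairsE)
    have "class_of E u = class_of E v"
      using that e joined_edge class_of_eq_iff by metis
    then have "u \<in> S \<longleftrightarrow> v \<in> S"
      using class_of_eq[OF assms(2)] class_of_self by metis
    with e show ?thesis by (auto simp: mem_vertex_pairs)
  qed
  then show ?thesis by blast
qed

text \<open>Once \<open>S\<close> is known to be a class, the presence of another class is a
  property of the graph induced on \<open>V - S\<close>. This allows two classes to be counted one
  after the other.\<close>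

lemma other_class_iff:
  assumes "E \<subseteq> vertex_pairs V" "S \<in> classes V E" "T \<noteq> S"
  shows "T \<in> classes V E \<longleftrightarrow> T \<in> classes (V - S) (E \<inter> vertex_pairs (V - S))"
proof -
  note S = classes_subset[OF assms(1,2)]
  let ?E = "E \<inter> vertex_pairs S" and ?F = "E \<inter> vertex_pairs (V - S)"
  have "classes S ?E = {S}"
    using mem_classes_Un_iff[OF _ _ S, of ?E ?F] edges_split[OF assms(1,2)] assms(2) by simp
  moreover have "classes V E = classes S ?E \<union> classes (V - S) ?F"
    using classes_Un[of ?E S ?F "V - S"] edges_split[OF assms(1,2)] S by (simp add: Un_absorb1)
  ultimately show ?thesis using assms(3) by simp
qed

text \<open>A graph with \<open>S\<close> as a class is the disjoint union of a connected graph on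
  \<open>S\<close>, with \<open>j\<close> edges say, and an arbitrary graph on \<open>V - S\<close>
  with the remaining edges. The predicate \<open>P\<close> on the second part is trivial when one
  class is counted, and demands a second class when two are.\<close>

lemma card_graphs_with_class:
  assumes "finite V" "S \<subseteq> V"
  shows "card {E. E \<subseteq> vertex_pairs V \<and> card E = m \<and> S \<in> classes V E \<and> P (E \<inter> vertex_pairs (V - S))} =
    (\<Sum>j\<le>m. num_connected (card S) j *
       card {F. F \<subseteq> vertex_pairs (V - S) \<and> card F = m - j \<and> P F})"
    (is "card ?L = _")
proof -
  let ?Fs = "\<lambda>j. {F. F \<subseteq> vertex_pairs (V - S) \<and> card F = m - j \<and> P F}"
  let ?R = "SIGMA j:{..m}. connected_graphs S j \<times> ?Fs j"
  have finS: "finite S" using assms finite_subset by blast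
  have fin: "finite E" if "E \<subseteq> vertex_pairs V" for E
    using that assms(1) finite_vertex_pairs finite_subset by blast
  have sub: "vertex_pairs S \<subseteq> vertex_pairs V" "vertex_pairs (V - S) \<subseteq> vertex_pairs V"
    using assms(2) by (intro vertex_pairs_mono; blast)+
  have disj: "vertex_pairs S \<inter> vertex_pairs (V - S) = {}"
    by (intro vertex_pairs_disjoint) auto
  have "bij_betw (\<lambda>(j, E, F). E \<union> F) ?R ?L"
  proof (rule bij_betw_byWitness[where f' =
        "\<lambda>E. (card (E \<inter> vertex_pairs S), E \<inter> vertex_pairs S, E \<inter> vertex_pairs (V - S))"])
    have *: "E \<union> F \<in> ?L \<and> (E \<union> F) \<inter> vertex_pairs S = E \<and> (E \<union> F) \<inter> vertex_pairs (V - S) = F"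
      if "j \<le> m" "E \<in> connected_graphs S j" "F \<in> ?Fs j" for j E F
    proof -
      have EF: "E \<subseteq> vertex_pairs S" "card E = j" "classes S E = {S}"
        "F \<subseteq> vertex_pairs (V - S)" "card F = m - j" "P F"
        using that by (simp_all add: connected_graphs_def)
      have "E \<inter> F = {}" using EF(1,4) disj by blast
      moreover have "finite E" "finite F" using EF(1,4) sub fin by (meson subset_trans)+
      ultimately have "card (E \<union> F) = m" using EF(2,5) \<open>j \<le> m\<close> by (simp add: card_Un_disjoint)
      moreover have 1: "(E \<union> F) \<inter> vertex_pairs S = E" "(E \<union> F) \<inter> vertex_pairs (V - S) = F"
        using EF(1,4) disj by blast+
      moreover have "S \<in> classes V (E \<union> F)"
        using mem_classes_Un_iff[OF EF(1,4) assms(2)] EF(3) by blast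
      moreover have "E \<union> F \<subseteq> vertex_pairs V" using EF(1,4) sub by blast
      ultimately show ?thesis using EF(6) by simp
    qed
    have mem: "j \<le> m \<and> E \<in> connected_graphs S j \<and> F \<in> ?Fs j"
      if "(j, E, F) \<in> ?R" for j E F
      using that by simp
    show "\<forall>x\<in>?R. (\<lambda>E. (card (E \<inter> vertex_pairs S), E \<inter> vertex_pairs S,
        E \<inter> vertex_pairs (V - S))) ((\<lambda>(j, E, F). E \<union> F) x) = x"
    proof
      fix x assume x: "x \<in> ?R"
      obtain j E F where [simp]: "x = (j, E, F)" by (metis prod_cases3)
      have jEF: "j \<le> m" "E \<in> connected_graphs S j" "F \<in> ?Fs j" using mem x by auto
      have "card E = j" using jEF(2) by (simp add: connected_graphs_def)
      then show "(\<lambda>E. (card (E \<inter> vertex_pairs S), E \<inter> vertex_pairs S,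
        E \<inter> vertex_pairs (V - S))) ((\<lambda>(j, E, F). E \<union> F) x) = x"
        using *[OF jEF] by (auto simp del: Int_Un_distrib2)
    qed
    show "(\<lambda>(j, E, F). E \<union> F) ` ?R \<subseteq> ?L"
    proof (rule image_subsetI)
      fix x assume x: "x \<in> ?R"
      obtain j E F where [simp]: "x = (j, E, F)" by (metis prod_cases3)
      have jEF: "j \<le> m" "E \<in> connected_graphs S j" "F \<in> ?Fs j" using mem x by auto
      have "E \<union> F \<in> ?L" using *[OF jEF] by (rule conjunct1)
      then show "(\<lambda>(j, E, F). E \<union> F) x \<in> ?L" by simp
    qed
    show "\<forall>E\<in>?L. (\<lambda>(j, E, F). E \<union> F) (card (E \<inter> vertex_pairs S), E \<inter> vertex_pairs S,
        E \<inter> vertex_pairs (V - S)) = E"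
      using edges_split[of _ V S] by simp
    show "(\<lambda>E. (card (E \<inter> vertex_pairs S), E \<inter> vertex_pairs S, E \<inter> vertex_pairs (V - S))) ` ?L \<subseteq> ?R"
    proof (rule image_subsetI)
      fix E assume E: "E \<in> ?L"
      let ?E = "E \<inter> vertex_pairs S" and ?F = "E \<inter> vertex_pairs (V - S)"
      have split: "?E \<union> ?F = E" using E by (intro edges_split) simp_all
      have "card ?E + card ?F = card (?E \<union> ?F)"
        using disj fin[of E] E by (intro card_Un_disjoint[symmetric]) auto
      then have "card ?E + card ?F = m" using split E by simp
      moreover have "classes S ?E = {S}"
        using mem_classes_Un_iff[OF _ _ assms(2), of ?E ?F] E unfolding split by simp
      moreover have "P ?F" using E by simp
      ultimately show "(card ?E, ?E, ?F) \<in> ?R"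
        by (simp add: connected_graphs_def)
    qed
  qed
  then have "card ?L = card ?R" by (rule bij_betw_same_card[symmetric])
  also have "\<dots> = (\<Sum>j\<le>m. card (connected_graphs S j \<times> ?Fs j))"
  proof (rule card_SigmaI)
    show "\<forall>j\<in>{..m}. finite (connected_graphs S j \<times> ?Fs j)"
      using finite_connected_graphs[OF finS] finite_vertex_pairs[of "V - S"] assms(1) by simp
  qed simp
  finally show ?thesis
    by (simp add: card_cartesian_product card_connected_graphs[OF finS])
qed

lemma card_graphs:
  assumes "finite V"
  shows "card {E. E \<subseteq> vertex_pairs V \<and> card E = m} = (card V choose 2) choose m"
  by (simp add: n_subsets finite_vertex_pairs card_vertex_pairs assms)

text \<open>For \<open>k \<le> n\<close> this is the number of graphs with \<open>n\<close> vertices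
  and \<open>m\<close> edges in which a fixed \<open>k\<close>-set is a class, split by the number
  \<open>j\<close> of edges inside the set.\<close>

definition class_count :: "nat \<Rightarrow> nat \<Rightarrow> nat \<Rightarrow> nat" where
  "class_count k n m = (\<Sum>j\<le>m. num_connected k j * ((n - k choose 2) choose (m - j)))"

lemma card_graphs_one_class:
  assumes "finite V" "S \<subseteq> V"
  shows "card {E. E \<subseteq> vertex_pairs V \<and> card E = m \<and> S \<in> classes V E} =
    class_count (card S) (card V) m"
  using card_graphs_with_class[OF assms, of m "\<lambda>_. True"] assms finite_subset[OF assms(2,1)]
  by (simp add: card_graphs card_Diff_subset class_count_def)

lemma card_graphs_two_classes:
  assumes "finite V" "S \<subseteq> V" "T \<subseteq> V" "S \<inter> T = {}" "S \<noteq> {}"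
  shows "card {E. E \<subseteq> vertex_pairs V \<and> card E = m \<and> S \<in> classes V E \<and> T \<in> classes V E} =
    (\<Sum>j\<le>m. num_connected (card S) j * class_count (card T) (card V - card S) (m - j))"
proof -
  have "T \<noteq> S" using assms by auto
  then have "{E. E \<subseteq> vertex_pairs V \<and> card E = m \<and> S \<in> classes V E \<and> T \<in> classes V E} =
    {E. E \<subseteq> vertex_pairs V \<and> card E = m \<and> S \<in> classes V E \<and>
       T \<in> classes (V - S) (E \<inter> vertex_pairs (V - S))}"
    using other_class_iff by blast
  moreover have "T \<subseteq> V - S" using assms by auto
  ultimately show ?thesis
    using card_graphs_with_class[OF assms(1,2), of m "\<lambda>F. T \<in> classes (V - S) F"]
      assms(1,2) finite_subset[OF assms(2,1)]
    by (simp add: card_graphs_one_class card_Diff_subset)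
qed

section \<open>Components of digraphs as connectivity classes\<close>

lemma edges_mem_iff:
  assumes "pair_graph G"
  shows "{u, v} \<in> edges G \<longleftrightarrow> (u, v) \<in> parcs G"
proof -
  interpret pair_graph G by fact
  show ?thesis
    using pair_sym_arcs by (auto simp: edges_def doubleton_eq_iff symmetric_def dest: symD)
qed

lemma edges_subset_vertex_pairs:
  assumes "pair_graph G"
  shows "edges G \<subseteq> vertex_pairs (pverts G)"
proof -
  interpret pair_graph G by fact
  show ?thesis
    using in_arcsD1 in_arcsD2 pair_no_loops by (fastforce simp: edges_def mem_vertex_pairs)
qed

lemma pair_graph_of_edges:
  assumes "finite V" "E \<subseteq> vertex_pairs V"
  shows "pair_graph \<lparr>pverts = V, parcs = {(u, v). {u, v} \<in> E}\<rparr>"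
proof -
  have *: "u \<in> V \<and> v \<in> V \<and> u \<noteq> v" if "{u, v} \<in> E" for u v
    using subsetD[OF assms(2) that] by (simp add: mem_vertex_pairs)
  have "finite {(u, v). {u, v} \<in> E}"
    by (rule finite_subset[of _ "V \<times> V"]) (use * assms(1) in auto)
  moreover have "fst p \<in> V \<and> snd p \<in> V \<and> fst p \<noteq> snd p" if "p \<in> {(u, v). {u, v} \<in> E}" for p
    using *[of "fst p" "snd p"] that by (simp add: split_def)
  moreover have "sym {(u, v). {u, v} \<in> E}"
    by (intro symI) (simp add: insert_commute)
  ultimately show ?thesis
    using assms(1) by unfold_locales (simp_all add: symmetric_def)
qed

lemma edges_of_edges:
  assumes "E \<subseteq> vertex_pairs V"
  shows "edges \<lparr>pverts = V, parcs = {(u, v). {u, v} \<in> E}\<rparr> = E"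
proof -
  have "\<exists>u v. e = {u, v} \<and> {u, v} \<in> E" if "e \<in> E" for e
    using subsetD[OF assms that] that by (auto elim!: vertex_pairsE)
  then show ?thesis by (auto simp: edges_def)
qed

lemma bij_betw_edges:
  "bij_betw edges (labeled_graphs n m) {E. E \<subseteq> vertex_pairs {1..n} \<and> card E = m}"
proof (rule bij_betw_byWitness[where f' = "\<lambda>E. \<lparr>pverts = {1..n}, parcs = {(u, v). {u, v} \<in> E}\<rparr>"])
  show "\<forall>G\<in>labeled_graphs n m. \<lparr>pverts = {1..n}, parcs = {(u, v). {u, v} \<in> edges G}\<rparr> = G"
    by (auto simp: labeled_graphs_def edges_mem_iff)
  show "\<forall>E\<in>{E. E \<subseteq> vertex_pairs {1..n} \<and> card E = m}.
      edges \<lparr>pverts = {1..n}, parcs = {(u, v). {u, v} \<in> E}\<rparr> = E"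
    by (simp add: edges_of_edges)
  show "edges ` labeled_graphs n m \<subseteq> {E. E \<subseteq> vertex_pairs {1..n} \<and> card E = m}"
    unfolding labeled_graphs_def using edges_subset_vertex_pairs by fastforce
  show "(\<lambda>E. \<lparr>pverts = {1..n}, parcs = {(u, v). {u, v} \<in> E}\<rparr>) `
      {E. E \<subseteq> vertex_pairs {1..n} \<and> card E = m} \<subseteq> labeled_graphs n m"
    by (auto simp: labeled_graphs_def edges_of_edges intro!: pair_graph_of_edges)
qed

text \<open>The library notion of connectedness uses reachability in the symmetric closure of
  \<open>H\<close>. As \<open>G\<close> is symmetric, that closure adds only arcs of
  \<open>G\<close>. An arbitrary subgraph is allowed so that the lemma also applies to the
  competitors in the maximality condition.\<close>

lemma reachable_subset_joined:
  assumes "pair_graph G" "subgraph H (with_proj G)" "u \<rightarrow>\<^sup>*\<^bsub>with_proj (mk_symmetric H)\<^esub> v"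
  shows "(u, v) \<in> joined (edges G)"
proof -
  interpret pair_graph G by fact
  have sub: "arcs H \<subseteq> parcs G" "tail H = fst" "head H = snd"
    using assms(2) by (auto simp: subgraph_def compatible_def)
  have "(x, y) \<in> parcs G" if "(x, y) \<in> parcs (mk_symmetric H)" for x y
    using that sub pair_sym_arcs by (auto simp: parcs_mk_symmetric symmetric_def dest: symD)
  then have step: "(x, y) \<in> joined (edges G)" if "(x, y) \<in> parcs (mk_symmetric H)" for x y
    using that joined_edge edges_mem_iff[OF assms(1)] by metis
  have "(u, v) \<in> rtrancl_on (verts H) (parcs (mk_symmetric H))"
    using assms(3) by (simp add: reachable_def)
  then show ?thesis
  proof (induction rule: rtrancl_on.induct)
    case (rtrancl_on_into_rtrancl_on a b c)
    then show ?case using step joined_trans by metis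
  qed simp
qed

text \<open>Every vertex on a path of \<open>G\<close> that starts in the class is itself joined to
  the start, so the path survives in the induced subgraph. Nonemptiness of classes is needed as the
  library excludes the graph without vertices.\<close>

lemma induce_class_connected:
  assumes "pair_graph G" "C \<in> classes (pverts G) (edges G)"
  shows "Digraph_Component.connected (with_proj G \<restriction> C)"
proof -
  interpret pair_graph G by fact
  let ?H = "with_proj G \<restriction> C"
  have arcs: "(x, y) \<in> parcs (mk_symmetric ?H)" if "(x, y) \<in> parcs G" "x \<in> C" "y \<in> C" for x y
    using that by (force simp: parcs_mk_symmetric)
  have "(u, v) \<in> rtrancl_on C (parcs (mk_symmetric ?H))" if "(u, v) \<in> joined (edges G)" "u \<in> C" for u v
    using that unfolding joined_def
  proof (induction rule: rtrancl_induct)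
    case (step y z)
    have uy: "(u, y) \<in> joined (edges G)" using step.hyps(1) by (simp add: joined_def)
    have yz: "{y, z} \<in> edges G" using step.hyps(2) by simp
    have uz: "(u, z) \<in> joined (edges G)" using joined_trans[OF uy joined_edge[OF yz]] .
    have C: "C = class_of (edges G) u" using class_of_eq[OF assms(2) step.prems] by simp
    have "y \<in> C" "z \<in> C" unfolding C mem_class_of by (fact uy, fact uz)
    moreover have "(y, z) \<in> parcs G" using yz by (simp add: edges_mem_iff[OF assms(1)])
    ultimately have "(y, z) \<in> parcs (mk_symmetric ?H)" by (intro arcs)
    from step.IH[OF step.prems] this \<open>z \<in> C\<close> show ?case
      by (rule rtrancl_on_into_rtrancl_on)
  qed simp
  moreover have "(u, v) \<in> joined (edges G)" if "u \<in> C" "v \<in> C" for u v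
    using that(2) unfolding mem_class_of[symmetric] class_of_eq[OF assms(2) that(1)] .
  ultimately have "\<forall>u\<in>C. \<forall>v\<in>C. u \<rightarrow>\<^sup>*\<^bsub>with_proj (mk_symmetric ?H)\<^esub> v"
    by (simp add: reachable_def)
  then show ?thesis
    using classes_nonempty[OF assms(2)] by (simp add: connected_def strongly_connected_def)
qed

text \<open>A connected subgraph has its vertices in one class, hence lies in the subgraph induced
  by that class, which is connected; maximality forces equality. Conversely, a connected subgraph
  containing an induced class has no further vertex, and then no further arc, since the induced
  subgraph already has all arcs between its vertices.\<close>

lemma components_eq:
  assumes "pair_graph G"
  shows "components G = (\<lambda>C. with_proj G \<restriction> C) ` classes (pverts G) (edges G)"
proof (intro equalityI subsetI)
  interpret pair_graph G by fact
  fix H assume "H \<in> components G"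
  then have H: "subgraph H (with_proj G)" "Digraph_Component.connected H"
    and max: "\<And>H'. subgraph H H' \<Longrightarrow> subgraph H' (with_proj G) \<Longrightarrow> Digraph_Component.connected H' \<Longrightarrow> H' = H"
    by (auto simp: components_def max_subgraph_def)
  obtain u where u: "u \<in> verts H"
    using H(2) by (auto simp: connected_def strongly_connected_def)
  have uG: "u \<in> pverts G" using u subgraph_imp_subverts[OF H(1)] by auto
  define C where "C = class_of (edges G) u"
  have C: "C \<in> classes (pverts G) (edges G)" using uG by (simp add: C_def classes_def)
  have sub: "verts H \<subseteq> C"
    using H(2) u reachable_subset_joined[OF assms H(1)]
    by (auto simp: C_def mem_class_of connected_def strongly_connected_def)
  have CG: "C \<subseteq> pverts G"
    using classes_subset[OF edges_subset_vertex_pairs[OF assms] C] .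
  have "subgraph (with_proj G \<restriction> C) (with_proj G)"
    using CG by (intro subgraph_induce_subgraphI) auto
  moreover have "subgraph H (with_proj G \<restriction> C)"
  proof -
    have "fst e \<in> C \<and> snd e \<in> C" if "e \<in> arcs H" for e
      using wf_digraph.wellformed[of H e] H(1) sub that by (auto simp: subgraph_def compatible_def)
    then show ?thesis
      using H(1) sub by (auto simp: subgraph_def compatible_def wellformed_induce_subgraph)
  qed
  ultimately have "with_proj G \<restriction> C = H"
    using max induce_class_connected[OF assms C] by blast
  with C show "H \<in> (\<lambda>C. with_proj G \<restriction> C) ` classes (pverts G) (edges G)" by blast
next
  interpret pair_graph G by fact
  fix H assume "H \<in> (\<lambda>C. with_proj G \<restriction> C) ` classes (pverts G) (edges G)"
  then obtain C where C: "C \<in> classes (pverts G) (edges G)" and H: "H = with_proj G \<restriction> C" by blast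
  have CG: "C \<subseteq> pverts G"
    using classes_subset[OF edges_subset_vertex_pairs[OF assms] C] .
  have "H' = H" if H': "subgraph H H'" "subgraph H' (with_proj G)" "Digraph_Component.connected H'" for H'
  proof -
    obtain u where u: "u \<in> C" using classes_nonempty[OF C] by blast
    have verts: "C \<subseteq> verts H'" using H'(1) by (auto simp: H subgraph_def)
    have "verts H' \<subseteq> class_of (edges G) u"
      using H'(3) u verts reachable_subset_joined[OF assms H'(2)]
      by (auto simp: mem_class_of connected_def strongly_connected_def)
    then have "verts H' = C" using verts class_of_eq[OF C u] by blast
    have "subgraph H' (with_proj G \<restriction> verts H')"
      using H'(2) by (intro subgraph_induce_subgraphI2) auto
    then have "arcs H' \<subseteq> arcs H" by (auto simp: H \<open>verts H' = C\<close> subgraph_def)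
    moreover have "arcs H \<subseteq> arcs H'" "tail H' = tail H" "head H' = head H"
      using H'(1) by (auto simp: subgraph_def compatible_def)
    moreover have "verts H' = verts H" by (simp add: H \<open>verts H' = C\<close>)
    ultimately show "H' = H" by (intro pre_digraph.equality) auto
  qed
  moreover have "subgraph H (with_proj G)"
    using CG unfolding H by (intro subgraph_induce_subgraphI) auto
  ultimately show "H \<in> components G"
    using induce_class_connected[OF assms C]
    by (auto simp: components_def max_subgraph_def H)
qed

lemma num_components_eq:
  assumes "pair_graph G"
  shows "num_components k G = card {C \<in> classes (pverts G) (edges G). card C = k}"
proof -
  have "{H \<in> components G. card (verts H) = k} =
      (\<lambda>C. with_proj G \<restriction> C) ` {C \<in> classes (pverts G) (edges G). card C = k}"
    by (auto simp: components_eq[OF assms])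
  moreover have "inj_on (\<lambda>C. with_proj G \<restriction> C) A" for A
    by (rule inj_on_inverseI[of _ verts]) simp
  ultimately show ?thesis by (simp add: num_components_def card_image)
qed

section \<open>Asymptotics of the counts\<close>

text \<open>Up to the factor \<open>fact k\<close>, the binomial coefficient is a product of
  \<open>k\<close> factors \<open>N n - i\<close>; after division by \<open>f n\<close> the shift by
  \<open>i\<close> vanishes in the limit. The scale \<open>f\<close> is left open, as both
  \<open>n\<close> and \<open>n ^ 2\<close> occur.\<close>

lemma choose_ratio_tendsto:
  fixes N :: "nat \<Rightarrow> nat" and f :: "nat \<Rightarrow> real"
  assumes "(\<lambda>n. N n / f n) \<longlonglongrightarrow> a" "filterlim f at_top sequentially"
  shows "(\<lambda>n. (N n choose k) / f n ^ k) \<longlonglongrightarrow> a ^ k / fact k"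
proof -
  have eq: "(N n choose k) / f n ^ k = (\<Prod>i<k. N n / f n - real i / f n) / fact k" for n
  proof -
    have "real (N n choose k) = (\<Prod>i<k. real (N n) - real i) / fact k"
      by (simp add: binomial_gbinomial gbinomial_prod_rev atLeast0LessThan)
    moreover have "(\<Prod>i<k. N n / f n - real i / f n) = (\<Prod>i<k. real (N n) - real i) / f n ^ k"
      by (simp add: prod_dividef flip: diff_divide_distrib)
    ultimately show ?thesis by simp
  qed
  have "(\<lambda>n. \<Prod>i<k. N n / f n - real i / f n) \<longlonglongrightarrow> (\<Prod>i<k. a - 0)"
    using assms by (intro tendsto_prod tendsto_diff tendsto_divide_0[OF tendsto_const])
      (auto intro: filterlim_at_top_imp_at_infinity)
  then show ?thesis unfolding eq by (intro tendsto_divide) auto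
qed

lemma real_choose_two: "real (n choose 2) = real n * (real n - 1) / 2"
  by (simp add: binomial_gbinomial gbinomial_prod_rev numeral_2_eq_2)

text \<open>Choosing \<open>m\<close> elements and then \<open>m - j\<close> of them amounts to
  choosing \<open>m - j\<close> elements and then \<open>j\<close> of the remaining
  \<open>M - m + j\<close>. In this form the only factor with a growing lower index does not depend
  on \<open>j\<close>.\<close>

lemma choose_quotient:
  assumes "m \<le> M" "j \<le> m"
  shows "real (M choose (m - j)) = real (M choose m) * real (m choose j) / real (M - m + j choose j)"
proof -
  have "(M choose m) * (m choose (m - j)) = (M choose (m - j)) * (M - (m - j) choose (m - (m - j)))"
    using assms by (intro choose_mult) auto
  moreover have "m choose (m - j) = m choose j" using assms(2) by (rule binomial_symmetric[symmetric])
  moreover have "M - (m - j) = M - m + j" "m - (m - j) = j" using assms by auto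
  ultimately have "real (M choose m) * real (m choose j) = real (M choose (m - j)) * real (M - m + j choose j)"
    by (metis of_nat_mult)
  moreover have "M - m + j choose j > 0" by simp
  ultimately show ?thesis by (simp add: field_simps)
qed

lemma choose_ratio_prod:
  assumes "m \<le> N"
  shows "real (M choose m) / real (N choose m) = (\<Prod>i<m. (real M - real i) / (real N - real i))"
proof -
  have "real (M choose m) = (\<Prod>i<m. real M - real i) / fact m" for M
    by (simp add: binomial_gbinomial gbinomial_prod_rev atLeast0LessThan)
  then show ?thesis by (simp add: prod_dividef)
qed

text \<open>With \<open>D = N - M\<close>, the factors of the ratio are
  \<open>1 - D / (N - i)\<close>, where \<open>N - i\<close> lies between \<open>N - m\<close> and
  \<open>N\<close>. Hence each factor is at most \<open>exp (- D / N)\<close> and at least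
  \<open>1 - x\<close>; the latter is bounded by \<open>ln (1 - x) \<ge> - x - 2 * x ^ 2\<close>,
  valid for \<open>0 \<le> x \<le> 1 / 2\<close>.\<close>

lemma choose_ratio_bounds:
  assumes "m \<le> M" "M \<le> N" "m < N" and x: "x = (real N - M) / (real N - m)" "x \<le> 1 / 2"
  shows "real (M choose m) / real (N choose m) \<le> exp (- (m * ((real N - M) / N)))"
    and "exp (- (m * x + 2 * (m * x * x))) \<le> real (M choose m) / real (N choose m)"
proof -
  let ?D = "real N - M"
  have D: "?D \<ge> 0" using assms by simp
  have quot: "(real M - real i) / (real N - real i) = 1 - ?D / (real N - real i)" if "i < m" for i
    using that assms by (simp add: field_simps)
  have x0: "x \<ge> 0" using assms D by simp
  have "real (M choose m) / real (N choose m) = (\<Prod>i<m. 1 - ?D / (real N - real i))"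
    using choose_ratio_prod[of m N M] assms quot by simp
  also have "\<dots> \<le> (\<Prod>i<m. exp (- (?D / N)))"
  proof (rule prod_mono)
    fix i assume "i \<in> {..<m}"
    then have i: "i < m" by simp
    have "0 \<le> (real M - real i) / (real N - real i)" using i assms by simp
    moreover have "?D / N \<le> ?D / (real N - real i)"
      using i assms D by (intro divide_left_mono) auto
    moreover have "1 - ?D / N \<le> exp (- (?D / N))"
      using exp_ge_add_one_self[of "- (?D / N)"] by simp
    ultimately show "0 \<le> 1 - ?D / (real N - real i) \<and> 1 - ?D / (real N - real i) \<le> exp (- (?D / N))"
      using quot[OF i] by linarith
  qed
  also have "\<dots> = exp (- (m * (?D / N)))"
    by (simp flip: exp_of_nat_mult)
  finally show "real (M choose m) / real (N choose m) \<le> exp (- (m * (?D / N)))" .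
  have "exp (- (m * x + 2 * (m * x * x))) = exp (- x - 2 * x ^ 2) ^ m"
    by (simp add: algebra_simps power2_eq_square flip: exp_of_nat_mult)
  also have "\<dots> \<le> (1 - x) ^ m"
  proof (rule power_mono)
    have "- x - 2 * x ^ 2 \<le> ln (1 - x)"
      using ln_one_minus_pos_lower_bound[OF x0 x(2)] .
    then have "exp (- x - 2 * x ^ 2) \<le> exp (ln (1 - x))" by (simp only: exp_le_cancel_iff)
    then show "exp (- x - 2 * x ^ 2) \<le> 1 - x" using x(2) by simp
  qed simp
  also have "\<dots> = (\<Prod>i<m. 1 - x)" by simp
  also have "\<dots> \<le> (\<Prod>i<m. 1 - ?D / (real N - real i))"
  proof (rule prod_mono)
    fix i assume "i \<in> {..<m}"
    then have i: "i < m" by simp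
    have "?D / (real N - real i) \<le> x"
      unfolding x(1) using i assms D by (intro divide_left_mono) auto
    then show "0 \<le> 1 - x \<and> 1 - x \<le> 1 - ?D / (real N - real i)" using x(2) by simp
  qed
  also have "\<dots> = real (M choose m) / real (N choose m)"
    using choose_ratio_prod[of m N M] assms quot by simp
  finally show "exp (- (m * x + 2 * (m * x * x))) \<le> real (M choose m) / real (N choose m)" .
qed

text \<open>The asymptotics depend on the edge numbers only through their limiting density, which
  keeps the floor function out of all estimates. Positivity of \<open>c\<close> makes
  \<open>m\<close> tend to infinity.\<close>

locale edge_density =
  fixes m :: "nat \<Rightarrow> nat" and c :: real
  assumes c_pos: "c > 0" and density: "(\<lambda>n. m n / n) \<longlonglongrightarrow> c"
begin

section \<open>Growth of the number of edges compared with the number of pairs\<close>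

lemma choose_two_tendsto: "(\<lambda>n. (n - s choose 2) / real n ^ 2) \<longlonglongrightarrow> 1 / 2"
proof (rule Lim_transform_eventually)
  show "(\<lambda>n. (real n - s) * (real n - s - 1) / 2 / real n ^ 2) \<longlonglongrightarrow> 1 / 2" by real_asymp
  show "\<forall>\<^sub>F n in sequentially. (real n - s) * (real n - s - 1) / 2 / real n ^ 2 = (n - s choose 2) / real n ^ 2"
    using eventually_ge_at_top[of s] by eventually_elim (simp add: real_choose_two of_nat_diff)
qed

lemma edges_over_square: "(\<lambda>n. m n / real n ^ 2) \<longlonglongrightarrow> 0"
proof -
  have "(\<lambda>n. m n / n * (1 / real n)) \<longlonglongrightarrow> c * 0"
    by (intro tendsto_mult density) real_asymp
  then show ?thesis by (simp add: power2_eq_square)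
qed

lemma eventually_edges_less: "\<forall>\<^sub>F n in sequentially. m n < (n - s choose 2)"
proof -
  \<comment> \<open>Any constant strictly between the limits 0 and 1/2 separates the two
    quotients.\<close>
  have "\<forall>\<^sub>F n in sequentially. m n / real n ^ 2 < 1 / 4"
    using order_tendstoD(2)[OF edges_over_square, of "1 / 4"] by simp
  moreover have "\<forall>\<^sub>F n in sequentially. 1 / 4 < (n - s choose 2) / real n ^ 2"
    by (rule order_tendstoD(1)[OF choose_two_tendsto]) simp
  ultimately show ?thesis using eventually_gt_at_top[of 0]
  proof eventually_elim
    case (elim n)
    then have "m n / real n ^ 2 < (n - s choose 2) / real n ^ 2" by linarith
    then show ?case using elim by (simp add: divide_less_cancel)
  qed
qed

lemma edges_at_top: "filterlim m at_top sequentially"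
proof -
  have "filterlim (\<lambda>n. m n / n * real n) at_top sequentially"
    by (rule filterlim_tendsto_pos_mult_at_top[OF density c_pos]) real_asymp
  moreover have "\<forall>\<^sub>F n in sequentially. m n / n * real n = m n"
    using eventually_gt_at_top[of 0] by eventually_elim simp
  ultimately have "filterlim (\<lambda>n. real (m n)) at_top sequentially"
    using filterlim_cong[OF refl refl] by metis
  then show ?thesis
    by (simp add: filterlim_at_top eventually_sequentially) (metis of_nat_le_iff)
qed

text \<open>There are \<open>D n \<sim> s * n\<close> pairs meeting the \<open>s\<close> vertices,
  out of \<open>N n \<sim> n ^ 2 / 2\<close>, so \<open>m n * (D n / N n)\<close> tends to
  \<open>2 * c * s\<close>. Replacing \<open>N n\<close> by \<open>N n - m n\<close> does not change
  this limit, as \<open>m n\<close> is of lower order, so both bounds of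
  \<open>choose_ratio_bounds\<close> converge to the same value; their quadratic correction vanishes
  with \<open>x n\<close>.\<close>

lemma avoid_vertices_tendsto:
  "(\<lambda>n. ((n - s choose 2) choose m n) / ((n choose 2) choose m n)) \<longlonglongrightarrow> exp (- (2 * c * s))"
proof -
  define N where "N n = n choose 2" for n
  define M where "M n = n - s choose 2" for n
  define D where "D n = (real (N n) - M n)" for n
  define x where "x n = D n / (real (N n) - m n)" for n
  have N: "(\<lambda>n. N n / real n ^ 2) \<longlonglongrightarrow> 1 / 2"
    using choose_two_tendsto[of 0] by (simp add: N_def)
  have "(\<lambda>n. (2 * s * real n - s ^ 2 - s) / 2 / n) \<longlonglongrightarrow> s" by real_asymp
  moreover have "\<forall>\<^sub>F n in sequentially. (2 * s * real n - s ^ 2 - s) / 2 / n = D n / n"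
    using eventually_ge_at_top[of s]
  proof eventually_elim
    case (elim n)
    then have Dn: "D n = (2 * s * real n - s ^ 2 - s) / 2"
      by (simp add: real_choose_two of_nat_diff D_def N_def M_def power2_eq_square field_simps)
    show ?case by (simp only: Dn)
  qed
  ultimately have D: "(\<lambda>n. D n / n) \<longlonglongrightarrow> s" by (rule Lim_transform_eventually)
  have "(\<lambda>n. (m n / n * (D n / n)) / (N n / real n ^ 2)) \<longlonglongrightarrow> c * s / (1 / 2)"
    by (intro tendsto_intros density D N) simp
  moreover have "\<forall>\<^sub>F n in sequentially. (m n / n * (D n / n)) / (N n / real n ^ 2) = m n * (D n / N n)"
    using eventually_gt_at_top[of 0] by eventually_elim (simp add: power2_eq_square)
  ultimately have upper: "(\<lambda>n. m n * (D n / N n)) \<longlonglongrightarrow> 2 * c * s"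
    by (simp add: tendsto_cong mult_ac)
  have den: "(\<lambda>n. N n / real n ^ 2 - m n / real n ^ 2) \<longlonglongrightarrow> 1 / 2 - 0"
    by (intro tendsto_diff N edges_over_square)
  have "(\<lambda>n. (m n / n * (D n / n)) / (N n / real n ^ 2 - m n / real n ^ 2)) \<longlonglongrightarrow> c * s / (1 / 2 - 0)"
    by (intro tendsto_divide tendsto_mult density D den) simp
  moreover have "\<forall>\<^sub>F n in sequentially. (m n / n * (D n / n)) / (N n / real n ^ 2 - m n / real n ^ 2) = m n * x n"
    using eventually_gt_at_top[of 0]
    by eventually_elim (simp add: x_def power2_eq_square flip: diff_divide_distrib)
  ultimately have lower: "(\<lambda>n. m n * x n) \<longlonglongrightarrow> 2 * c * s"
    by (simp add: tendsto_cong mult_ac)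
  \<comment> \<open>The product \<open>m n * x n\<close> converges while \<open>m n\<close> tends to
    infinity, which forces \<open>x\<close> to 0.\<close>
  have "(\<lambda>n. m n * x n / m n) \<longlonglongrightarrow> 0"
    by (rule tendsto_divide_0[OF lower])
       (intro filterlim_at_top_imp_at_infinity filterlim_compose[OF filterlim_real_sequentially edges_at_top])
  moreover have "\<forall>\<^sub>F n in sequentially. m n * x n / m n = x n"
    using filterlim_at_top[THEN iffD1, OF edges_at_top, rule_format, of 1]
    by eventually_elim simp
  ultimately have x: "x \<longlonglongrightarrow> 0" by (rule Lim_transform_eventually)
  then have "\<forall>\<^sub>F n in sequentially. x n < 1 / 2" by (rule order_tendstoD) simp
  then have bounds: "\<forall>\<^sub>F n in sequentially.
      exp (- (m n * x n + 2 * (m n * x n * x n))) \<le> (M n choose m n) / (N n choose m n) \<and>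
      (M n choose m n) / (N n choose m n) \<le> exp (- (m n * (D n / N n)))"
    using eventually_edges_less[of s]
  proof eventually_elim
    case (elim n)
    have "M n \<le> N n" by (simp add: M_def N_def binomial_right_mono)
    moreover have "m n < M n" using elim(2) by (simp add: M_def)
    ultimately have "m n \<le> M n" "M n \<le> N n" "m n < N n" by simp_all
    moreover have "x n = (real (N n) - M n) / (real (N n) - m n)" "x n \<le> 1 / 2"
      using elim(1) by (simp_all add: x_def D_def)
    ultimately show ?case
      unfolding D_def by (intro conjI choose_ratio_bounds)
  qed
  have "(\<lambda>n. exp (- (m n * x n + 2 * (m n * x n * x n)))) \<longlonglongrightarrow> exp (- (2 * c * s + 2 * (2 * c * s * 0)))"
    by (intro tendsto_intros lower x)
  then have 1: "(\<lambda>n. exp (- (m n * x n + 2 * (m n * x n * x n)))) \<longlonglongrightarrow> exp (- (2 * c * s))"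
    by simp
  have 2: "(\<lambda>n. exp (- (m n * (D n / N n)))) \<longlonglongrightarrow> exp (- (2 * c * s))"
    by (intro tendsto_intros upper)
  show ?thesis
    using tendsto_sandwich[OF bounds[THEN eventually_mono] bounds[THEN eventually_mono] 1 2]
    by (simp add: M_def N_def)
qed

text \<open>By \<open>choose_quotient\<close> the change from \<open>m n\<close> to
  \<open>m n - j\<close> costs the quotient of \<open>m n choose j\<close> and
  \<open>M n - m n + j choose j\<close>. These grow like \<open>(c * n) ^ j\<close> and
  \<open>(n ^ 2 / 2) ^ j\<close> up to the common \<open>fact j\<close>, whence the factor
  \<open>(2 * c) ^ j\<close> after multiplication by \<open>n ^ j\<close>.\<close>

lemma graph_ratio_tendsto:
  "(\<lambda>n. ((n - s choose 2) choose (m n - j)) / ((n choose 2) choose m n) * real n ^ j)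
     \<longlonglongrightarrow> (2 * c) ^ j * exp (- (2 * c * s))"
proof -
  define M where "M n = n - s choose 2" for n
  have sq: "filterlim (\<lambda>n. real n ^ 2) at_top sequentially" by real_asymp
  have "(\<lambda>n. M n / real n ^ 2 - m n / real n ^ 2 + j / real n ^ 2) \<longlonglongrightarrow> 1 / 2 - 0 + 0"
    unfolding M_def by (intro tendsto_intros choose_two_tendsto edges_over_square) real_asymp
  moreover have "\<forall>\<^sub>F n in sequentially. M n / real n ^ 2 - m n / real n ^ 2 + j / real n ^ 2 =
      (M n - m n + j) / real n ^ 2"
    using eventually_edges_less[of s]
    by eventually_elim (simp add: M_def of_nat_diff add_divide_distrib diff_divide_distrib)
  ultimately have "(\<lambda>n. (M n - m n + j) / real n ^ 2) \<longlonglongrightarrow> 1 / 2"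
    by (simp add: tendsto_cong)
  from choose_ratio_tendsto[OF this sq]
  have den: "(\<lambda>n. (M n - m n + j choose j) / (real n ^ 2) ^ j) \<longlonglongrightarrow> (1 / 2) ^ j / fact j" .
  have num: "(\<lambda>n. (m n choose j) / real n ^ j) \<longlonglongrightarrow> c ^ j / fact j"
    by (rule choose_ratio_tendsto[OF density filterlim_real_sequentially])
  have "(\<lambda>n. (M n choose m n) / ((n choose 2) choose m n) * ((m n choose j) / real n ^ j /
      ((M n - m n + j choose j) / (real n ^ 2) ^ j)))
      \<longlonglongrightarrow> exp (- (2 * c * s)) * (c ^ j / fact j / ((1 / 2) ^ j / fact j))"
    unfolding M_def by (intro tendsto_mult tendsto_divide avoid_vertices_tendsto num den[unfolded M_def]) simp
  moreover have "exp (- (2 * c * s)) * (c ^ j / fact j / ((1 / 2) ^ j / fact j)) =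
      (2 * c) ^ j * exp (- (2 * c * s))"
    by (simp add: power_mult_distrib power_divide)
  moreover have "\<forall>\<^sub>F n in sequentially. (M n choose m n) / ((n choose 2) choose m n) * ((m n choose j) / real n ^ j /
      ((M n - m n + j choose j) / (real n ^ 2) ^ j)) =
      ((n - s choose 2) choose (m n - j)) / ((n choose 2) choose m n) * real n ^ j"
    using eventually_edges_less[of s] eventually_gt_at_top[of 0]
      filterlim_at_top[THEN iffD1, OF edges_at_top, rule_format, of j]
  proof eventually_elim
    case (elim n)
    then show ?case
      using choose_quotient[of "m n" "M n" j]
      by (simp add: M_def power2_eq_square power_mult_distrib mult_ac)
  qed
  ultimately show ?thesis using Lim_transform_eventually by fastforce
qed

text \<open>
  Multiplying by \<open>n ^ (k - 1)\<close> makes the terms with \<open>j \<ge> k\<close> vanish, and there is no connected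
  graph with \<open>j < k - 1\<close> edges.
\<close>

lemma tree_term_dominates:
  fixes f :: "nat \<Rightarrow> nat \<Rightarrow> real" and g :: "nat \<Rightarrow> real"
  assumes k: "k > 0" and f: "\<And>j. (\<lambda>n. f j n * real n ^ j) \<longlonglongrightarrow> g j"
  shows "(\<lambda>n. (\<Sum>j\<le>m n - i. num_connected k j * f j n) * real n ^ (k - 1))
    \<longlonglongrightarrow> num_connected k (k - 1) * g (k - 1)"
proof -
  \<comment> \<open>A fixed range containing every \<open>j\<close> with a nonzero coefficient,
    since a graph on \<open>k\<close> vertices has at most \<open>k choose 2\<close> edges; the
    added \<open>k\<close> puts the index \<open>k - 1\<close> of the trees visibly in
    range.\<close>
  let ?K = "(k choose 2) + k"
  have lim: "(\<lambda>n. num_connected k j * (f j n * real n ^ j) * (real n ^ (k - 1) / real n ^ j))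
      \<longlonglongrightarrow> num_connected k j * g j * (if j = k - 1 then 1 else 0)" for j
  proof (cases "j < k - 1")
    case True
    then show ?thesis by (simp add: num_connected_few_edges)
  next
    case False
    have "(\<lambda>n. real n ^ (k - 1) / real n ^ j) \<longlonglongrightarrow> (if j = k - 1 then 1 else 0)"
    proof -
      have 1: "(\<lambda>n. inverse (real n) ^ (j - (k - 1))) \<longlonglongrightarrow> 0 ^ (j - (k - 1))"
        by (intro tendsto_power) real_asymp
      have 2: "\<forall>\<^sub>F n in sequentially. inverse (real n) ^ (j - (k - 1)) = real n ^ (k - 1) / real n ^ j"
        using eventually_gt_at_top[of 0]
      proof eventually_elim
        case (elim n)
        obtain d where "j = k - 1 + d" using False by (metis le_Suc_ex not_less)
        then show ?case using elim by (simp add: power_add inverse_eq_divide power_one_over)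
      qed
      \<comment> \<open>The value \<open>0 ^ 0 = 1\<close> singles out the trees; the subtraction is
        exact because \<open>j \<ge> k - 1\<close> in this case.\<close>
      have 3: "(0 :: real) ^ (j - (k - 1)) = (if j = k - 1 then 1 else 0)"
        using False by (auto simp: power_0_left)
      show ?thesis using Lim_transform_eventually[OF 1 2] unfolding 3 .
    qed
    then show ?thesis by (intro tendsto_mult tendsto_const f)
  qed
  have "(\<lambda>n. \<Sum>j\<le>?K. num_connected k j * (f j n * real n ^ j) * (real n ^ (k - 1) / real n ^ j))
      \<longlonglongrightarrow> (\<Sum>j\<le>?K. num_connected k j * g j * (if j = k - 1 then 1 else 0))"
    by (intro tendsto_sum lim)
  also have "(\<Sum>j\<le>?K. num_connected k j * g j * (if j = k - 1 then 1 else 0)) =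
      num_connected k (k - 1) * g (k - 1)"
  proof -
    have "(\<Sum>j\<le>?K. num_connected k j * g j * (if j = k - 1 then 1 else 0)) =
        (\<Sum>j\<le>?K. if j = k - 1 then num_connected k j * g j else 0)"
      by (intro sum.cong) auto
    also have "\<dots> = num_connected k (k - 1) * g (k - 1)"
      by (subst sum.delta) auto
    finally show ?thesis .
  qed
  finally show ?thesis
  proof (rule Lim_transform_eventually)
    show "\<forall>\<^sub>F n in sequentially.
        (\<Sum>j\<le>?K. num_connected k j * (f j n * real n ^ j) * (real n ^ (k - 1) / real n ^ j)) =
        (\<Sum>j\<le>m n - i. num_connected k j * f j n) * real n ^ (k - 1)"
      using filterlim_at_top[THEN iffD1, OF edges_at_top, rule_format, of "?K + i"]
        eventually_gt_at_top[of 0]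
    proof eventually_elim
      case (elim n)
      have *: "(\<Sum>j\<le>m n - i. num_connected k j * f j n) = (\<Sum>j\<le>?K. num_connected k j * f j n)"
        using elim by (intro sum.mono_neutral_right) (auto simp: num_connected_many_edges)
      show ?case
        unfolding * sum_distrib_right using elim by (intro sum.cong) simp_all
    qed
  qed
qed

text \<open>The offsets \<open>s\<close> and \<open>i\<close> stand for the vertices and edges taken
  by a class that was split off before, while the count is still compared with all graphs on
  \<open>n\<close> vertices. The first moment uses \<open>s = i = 0\<close>, the second
  \<open>s = k\<close> with arbitrary \<open>i\<close>.\<close>

lemma class_count_tendsto:
  assumes "k > 0"
  shows "(\<lambda>n. class_count k (n - s) (m n - i) / ((n choose 2) choose m n) * real n ^ (k - 1) * real n ^ i)
    \<longlonglongrightarrow> num_connected k (k - 1) * ((2 * c) ^ (k - 1 + i) * exp (- (2 * c * (s + k))))"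
proof -
  have "(\<lambda>n. ((n - (s + k) choose 2) choose (m n - (j + i))) / ((n choose 2) choose m n) *
      real n ^ i * real n ^ j) \<longlonglongrightarrow> (2 * c) ^ (j + i) * exp (- (2 * c * (s + k)))" for j
    using graph_ratio_tendsto[of "s + k" "j + i"] by (simp add: power_add mult_ac)
  from tree_term_dominates[OF assms this, of i]
  have "(\<lambda>n. (\<Sum>j\<le>m n - i. num_connected k j * (((n - (s + k) choose 2) choose (m n - (j + i))) /
      ((n choose 2) choose m n) * real n ^ i)) * real n ^ (k - 1))
    \<longlonglongrightarrow> num_connected k (k - 1) * ((2 * c) ^ (k - 1 + i) * exp (- (2 * c * (s + k))))" .
  moreover have "(\<Sum>j\<le>m n - i. num_connected k j * (((n - (s + k) choose 2) choose (m n - (j + i))) /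
      ((n choose 2) choose m n) * real n ^ i)) * real n ^ (k - 1) =
      class_count k (n - s) (m n - i) / ((n choose 2) choose m n) * real n ^ (k - 1) * real n ^ i" for n
    unfolding class_count_def of_nat_sum sum_divide_distrib sum_distrib_right
    by (intro sum.cong) (simp_all add: add.commute mult_ac)
  ultimately show ?thesis by simp
qed

text \<open>The limit of the expected number of components of order \<open>k\<close>, divided by
  \<open>n\<close>. The number of trees is left unevaluated, so that the moment computations do not
  involve Cayley's formula.\<close>

definition limit_density :: "nat \<Rightarrow> real" where
  "limit_density k = num_connected k (k - 1) / fact k * (2 * c) ^ (k - 1) * exp (- (2 * c * k))"

lemma choose_shift_tendsto: "(\<lambda>n. (n - s choose k) / real n ^ k) \<longlonglongrightarrow> 1 / fact k"
proof -
  have "(\<lambda>n. (real n - s) / n) \<longlonglongrightarrow> 1" by real_asymp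
  moreover have "\<forall>\<^sub>F n in sequentially. (real n - s) / n = (n - s) / n"
    using eventually_ge_at_top[of s] by eventually_elim (simp add: of_nat_diff)
  ultimately have "(\<lambda>n. (n - s) / n) \<longlonglongrightarrow> 1" by (rule Lim_transform_eventually)
  from choose_ratio_tendsto[OF this filterlim_real_sequentially] show ?thesis by simp
qed

text \<open>About \<open>n ^ k / fact k\<close> sets are available, and each is a class with
  probability of order \<open>n ^ (-(k - 1))\<close>, so one power of \<open>n\<close>
  remains.\<close>

lemma first_moment_tendsto:
  assumes "k > 0"
  shows "(\<lambda>n. (n choose k) * class_count k n (m n) / ((n choose 2) choose m n) / n) \<longlonglongrightarrow> limit_density k"
proof -
  have 1: "(\<lambda>n. (n - 0 choose k) / real n ^ k *
      (class_count k (n - 0) (m n - 0) / ((n choose 2) choose m n) * real n ^ (k - 1) * real n ^ 0))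
      \<longlonglongrightarrow> 1 / fact k * (num_connected k (k - 1) * ((2 * c) ^ (k - 1 + 0) * exp (- (2 * c * (real 0 + k)))))"
    by (rule tendsto_mult[OF choose_shift_tendsto class_count_tendsto[OF assms]])
  have "real n ^ k = real n * real n ^ (k - 1)" for n
    using assms by (simp add: power_eq_if)
  then have 2: "\<forall>\<^sub>F n in sequentially. (n - 0 choose k) / real n ^ k *
      (class_count k (n - 0) (m n - 0) / ((n choose 2) choose m n) * real n ^ (k - 1) * real n ^ 0) =
      (n choose k) * class_count k n (m n) / ((n choose 2) choose m n) / n"
    using eventually_gt_at_top[of 0] by (simp add: eventually_mono)
  show ?thesis
    using Lim_transform_eventually[OF 1 2] by (simp add: limit_density_def mult.assoc)
qed

text \<open>The dominance of trees is used twice: inside \<open>class_count_tendsto\<close> for the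
  second set, and then for the first set, with the normalised inner counts in the role of
  \<open>f\<close>. The limit is a perfect square, which is the asymptotic independence of the two
  events.\<close>

lemma second_moment_tendsto:
  assumes "k > 0"
  shows "(\<lambda>n. (n choose k) * (n - k choose k) *
      (\<Sum>j\<le>m n. num_connected k j * class_count k (n - k) (m n - j)) / ((n choose 2) choose m n) / real n ^ 2)
    \<longlonglongrightarrow> limit_density k ^ 2"
proof -
  let ?S = "\<lambda>n. \<Sum>j\<le>m n. num_connected k j * class_count k (n - k) (m n - j)"
  let ?g = "\<lambda>j. num_connected k (k - 1) * ((2 * c) ^ (k - 1 + j) * exp (- (2 * c * (k + k))))"
  have "(\<lambda>n. (class_count k (n - k) (m n - j) / ((n choose 2) choose m n) * real n ^ (k - 1)) * real n ^ j)
      \<longlonglongrightarrow> ?g j" for j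
    using class_count_tendsto[OF assms, of k j] by simp
  from tree_term_dominates[OF assms this, of 0]
  have "(\<lambda>n. (\<Sum>j\<le>m n - 0. num_connected k j *
      (class_count k (n - k) (m n - j) / ((n choose 2) choose m n) * real n ^ (k - 1))) * real n ^ (k - 1))
      \<longlonglongrightarrow> num_connected k (k - 1) * ?g (k - 1)" .
  moreover have "(\<Sum>j\<le>m n - 0. num_connected k j *
      (class_count k (n - k) (m n - j) / ((n choose 2) choose m n) * real n ^ (k - 1))) * real n ^ (k - 1) =
      ?S n / ((n choose 2) choose m n) * real n ^ (k - 1) * real n ^ (k - 1)" for n
    unfolding of_nat_sum sum_divide_distrib sum_distrib_right by (intro sum.cong) simp_all
  ultimately have "(\<lambda>n. ?S n / ((n choose 2) choose m n) * real n ^ (k - 1) * real n ^ (k - 1))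
      \<longlonglongrightarrow> num_connected k (k - 1) * ?g (k - 1)" by simp
  then have 1: "(\<lambda>n. (n - 0 choose k) / real n ^ k * ((n - k choose k) / real n ^ k) *
      (?S n / ((n choose 2) choose m n) * real n ^ (k - 1) * real n ^ (k - 1)))
      \<longlonglongrightarrow> 1 / fact k * (1 / fact k) * (num_connected k (k - 1) * ?g (k - 1))"
    by (rule tendsto_mult[OF tendsto_mult[OF choose_shift_tendsto choose_shift_tendsto]])
  have 3: "1 / fact k * (1 / fact k) * (num_connected k (k - 1) * ?g (k - 1)) = limit_density k ^ 2"
    by (simp add: limit_density_def power2_eq_square power_add algebra_simps flip: exp_add)
  have "real n ^ k = real n * real n ^ (k - 1)" for n
    using assms by (simp add: power_eq_if)
  then have 2: "\<forall>\<^sub>F n in sequentially. (n - 0 choose k) / real n ^ k * ((n - k choose k) / real n ^ k) *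
      (?S n / ((n choose 2) choose m n) * real n ^ (k - 1) * real n ^ (k - 1)) =
      (n choose k) * (n - k choose k) * ?S n / ((n choose 2) choose m n) / real n ^ 2"
    using eventually_gt_at_top[of 0] by (simp add: eventually_mono power2_eq_square mult_ac)
  show ?thesis
    using Lim_transform_eventually[OF 1 2] unfolding 3 .
qed

end

section \<open>First and second moment\<close>

lemma card_classes_of_size:
  assumes "finite V" "E \<subseteq> vertex_pairs V"
  shows "real (card {C \<in> classes V E. card C = k}) =
    (\<Sum>S | S \<subseteq> V \<and> card S = k. of_bool (S \<in> classes V E))"
proof -
  have "{C \<in> classes V E. card C = k} = {S. S \<subseteq> V \<and> card S = k} \<inter> {S. S \<in> classes V E}"
    using classes_subset[OF assms(2)] by auto
  then show ?thesis using assms(1) by (simp add: sum.If_cases of_bool_def)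
qed

lemma sum_card_classes:
  assumes "finite V"
  shows "(\<Sum>E | E \<subseteq> vertex_pairs V \<and> card E = m. real (card {C \<in> classes V E. card C = k})) =
    (card V choose k) * class_count k (card V) m"
proof -
  let ?\<Omega> = "{E. E \<subseteq> vertex_pairs V \<and> card E = m}" and ?K = "{S. S \<subseteq> V \<and> card S = k}"
  have fin: "finite ?\<Omega>" using finite_vertex_pairs[OF assms] by simp
  have "(\<Sum>E\<in>?\<Omega>. real (card {C \<in> classes V E. card C = k})) =
      (\<Sum>E\<in>?\<Omega>. \<Sum>S\<in>?K. of_bool (S \<in> classes V E))"
    by (intro sum.cong refl card_classes_of_size assms) simp
  also have "\<dots> = (\<Sum>S\<in>?K. \<Sum>E\<in>?\<Omega>. of_bool (S \<in> classes V E))"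
    by (rule sum.swap)
  also have "\<dots> = (\<Sum>S\<in>?K. real (class_count k (card V) m))"
  proof (intro sum.cong refl)
    fix S assume S: "S \<in> ?K"
    have "(\<Sum>E\<in>?\<Omega>. of_bool (S \<in> classes V E)) = real (card (?\<Omega> \<inter> {E. S \<in> classes V E}))"
      using fin by (simp add: sum.If_cases of_bool_def)
    also have "?\<Omega> \<inter> {E. S \<in> classes V E} =
        {E. E \<subseteq> vertex_pairs V \<and> card E = m \<and> S \<in> classes V E}" by blast
    also have "card \<dots> = class_count k (card V) m"
      using S card_graphs_one_class[OF assms, of S m] by simp
    finally show "(\<Sum>E\<in>?\<Omega>. of_bool (S \<in> classes V E)) = real (class_count k (card V) m)" .
  qed
  finally show ?thesis by (simp add: n_subsets assms)
qed

text \<open>The square counts ordered pairs of classes. Equal pairs reproduce the first moment,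
  distinct overlapping sets cannot both be classes, and disjoint pairs are counted by
  \<open>card_graphs_two_classes\<close>.\<close>

lemma sum_card_classes_squared:
  assumes "finite V" "k > 0"
  shows "(\<Sum>E | E \<subseteq> vertex_pairs V \<and> card E = m. real (card {C \<in> classes V E. card C = k}) ^ 2) =
    (card V choose k) * class_count k (card V) m + (card V choose k) * (card V - k choose k) *
      (\<Sum>j\<le>m. num_connected k j * class_count k (card V - k) (m - j))"
proof -
  let ?\<Omega> = "{E. E \<subseteq> vertex_pairs V \<and> card E = m}" and ?K = "{S. S \<subseteq> V \<and> card S = k}"
  let ?both = "\<lambda>S T. {E. E \<subseteq> vertex_pairs V \<and> card E = m \<and> S \<in> classes V E \<and> T \<in> classes V E}"
  let ?W = "\<Sum>j\<le>m. num_connected k j * class_count k (card V - k) (m - j)"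
  have fin: "finite ?\<Omega>" using finite_vertex_pairs[OF assms(1)] by simp
  have finK: "finite ?K" using assms(1) by simp
  have both: "(\<Sum>T\<in>?K. real (card (?both S T))) = class_count k (card V) m + (card V - k choose k) * ?W"
    if S: "S \<in> ?K" for S
  proof -
    have S': "S \<subseteq> V" "card S = k" "S \<noteq> {}" "finite S"
      using S assms finite_subset by auto
    let ?D = "{T. T \<subseteq> V - S \<and> card T = k}"
    have "(\<Sum>T\<in>?K. real (card (?both S T))) = (\<Sum>T\<in>insert S ?D. real (card (?both S T)))"
    proof (rule sum.mono_neutral_right[OF finK])
      show "insert S ?D \<subseteq> ?K" using S by auto
      show "\<forall>T\<in>?K - insert S ?D. real (card (?both S T)) = 0"
      proof
        fix T assume T: "T \<in> ?K - insert S ?D"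
        then have "S \<inter> T \<noteq> {}" "S \<noteq> T" by auto
        then have "?both S T = {}" using classes_disjoint by blast
        then show "real (card (?both S T)) = 0" by (simp only: card.empty of_nat_0)
      qed
    qed
    also have "\<dots> = card (?both S S) + (\<Sum>T\<in>?D. real (card (?both S T)))"
      using assms(1) S'(3) by (intro sum.insert) auto
    also have "card (?both S S) = class_count k (card V) m"
      using card_graphs_one_class[OF assms(1) S'(1), of m] S'(2) by simp
    also have "(\<Sum>T\<in>?D. real (card (?both S T))) = (\<Sum>T\<in>?D. real ?W)"
    proof (intro sum.cong refl)
      fix T assume "T \<in> ?D"
      then have T: "T \<subseteq> V" "S \<inter> T = {}" "card T = k" by auto
      show "real (card (?both S T)) = real ?W"
        using card_graphs_two_classes[OF assms(1) S'(1) T(1,2) S'(3), of m] S'(2) T(3) by simp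
    qed
    also have "\<dots> = (card V - k choose k) * ?W"
      using S' assms(1) by (simp add: n_subsets card_Diff_subset)
    finally show ?thesis by simp
  qed
  have "(\<Sum>E\<in>?\<Omega>. real (card {C \<in> classes V E. card C = k}) ^ 2) =
      (\<Sum>E\<in>?\<Omega>. \<Sum>S\<in>?K. \<Sum>T\<in>?K. of_bool (S \<in> classes V E \<and> T \<in> classes V E))"
    using card_classes_of_size[OF assms(1)]
    by (intro sum.cong refl) (simp add: power2_eq_square sum_product of_bool_conj)
  also have "\<dots> = (\<Sum>S\<in>?K. \<Sum>E\<in>?\<Omega>. \<Sum>T\<in>?K. of_bool (S \<in> classes V E \<and> T \<in> classes V E))"
    by (rule sum.swap)
  also have "\<dots> = (\<Sum>S\<in>?K. \<Sum>T\<in>?K. \<Sum>E\<in>?\<Omega>. of_bool (S \<in> classes V E \<and> T \<in> classes V E))"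
    by (intro sum.cong refl sum.swap)
  also have "\<dots> = (\<Sum>S\<in>?K. \<Sum>T\<in>?K. real (card (?both S T)))"
  proof (intro sum.cong refl)
    fix S T
    have "(\<Sum>E\<in>?\<Omega>. of_bool (S \<in> classes V E \<and> T \<in> classes V E)) =
        real (card (?\<Omega> \<inter> {E. S \<in> classes V E \<and> T \<in> classes V E}))"
      using fin by (simp add: sum.If_cases of_bool_def)
    also have "?\<Omega> \<inter> {E. S \<in> classes V E \<and> T \<in> classes V E} = ?both S T" by blast
    finally show "(\<Sum>E\<in>?\<Omega>. of_bool (S \<in> classes V E \<and> T \<in> classes V E)) = real (card (?both S T))" .
  qed
  also have "\<dots> = (\<Sum>S\<in>?K. real (class_count k (card V) m + (card V - k choose k) * ?W))"
    using both by (intro sum.cong refl) simp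
  also have "\<dots> = (card V choose k) * (class_count k (card V) m + (card V - k choose k) * ?W)"
    by (simp add: n_subsets assms)
  finally show ?thesis by (simp add: algebra_simps)
qed

text \<open>Chebyshev's argument is applied to the deviation from \<open>x\<close> instead of from
  the mean, so the means need no separate treatment. A union bound over the finite set
  \<open>K\<close> yields one error sequence for all \<open>k\<close>. The conditions hold only
  eventually, as \<open>random_graph\<close> is unspecified for small \<open>n\<close>.\<close>

lemma aas_asymp_equalI_second_moment:
  fixes P :: "nat \<Rightarrow> 'a pmf" and X :: "'k \<Rightarrow> nat \<Rightarrow> 'a \<Rightarrow> real"
  assumes "finite K" and finP: "\<forall>\<^sub>F n in sequentially. finite (set_pmf (P n))"
    and pos: "\<And>k. k \<in> K \<Longrightarrow> \<forall>\<^sub>F n in sequentially. x k n > 0"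
    and lim: "\<And>k. k \<in> K \<Longrightarrow>
      (\<lambda>n. measure_pmf.expectation (P n) (\<lambda>\<omega>. (X k n \<omega> - x k n)\<^sup>2) / (x k n)\<^sup>2) \<longlonglongrightarrow> 0"
  shows "aas_asymp_equal K P X x"
proof -
  define \<delta> where "\<delta> k n = measure_pmf.expectation (P n) (\<lambda>\<omega>. (X k n \<omega> - x k n)\<^sup>2) / (x k n)\<^sup>2" for k n
  \<comment> \<open>The summand \<open>1 / (real n + 1)\<close> keeps \<eta> positive, so that
    division by its root is possible even when all deviations are 0.\<close>
  define \<eta> where "\<eta> n = (\<Sum>k\<in>K. \<delta> k n) + 1 / (real n + 1)" for n
  have \<delta>_nonneg: "\<delta> k n \<ge> 0" for k n by (simp add: \<delta>_def)
  have \<eta>_pos: "\<eta> n > 0" for n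
    unfolding \<eta>_def using \<delta>_nonneg by (intro add_nonneg_pos sum_nonneg) auto
  have "(\<lambda>n. 1 / (real n + 1)) \<longlonglongrightarrow> 0" by real_asymp
  moreover have "(\<lambda>n. \<Sum>k\<in>K. \<delta> k n) \<longlonglongrightarrow> 0"
    using lim unfolding \<delta>_def by (intro tendsto_null_sum)
  ultimately have "\<eta> \<longlonglongrightarrow> 0" unfolding \<eta>_def using tendsto_add by fastforce
  then have sqrt_\<eta>: "(\<lambda>n. sqrt (\<eta> n)) \<longlonglongrightarrow> 0" using tendsto_real_sqrt by fastforce
  \<comment> \<open>The bad event has probability at most
    \<open>\<eta> n / (\<epsilon> n)\<^sup>2\<close>; a fourth root makes both \<epsilon> and this
    bound, then \<open>sqrt (\<eta> n)\<close>, tend to 0.\<close>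
  define \<epsilon> where "\<epsilon> n = sqrt (sqrt (\<eta> n))" for n
  have \<epsilon>: "\<epsilon> \<longlonglongrightarrow> 0" unfolding \<epsilon>_def using tendsto_real_sqrt[OF sqrt_\<eta>] by simp
  define good where "good n = {\<omega>. \<forall>k\<in>K. (1 - \<epsilon> n) * x k n \<le> X k n \<omega> \<and> X k n \<omega> \<le> (1 + \<epsilon> n) * x k n}" for n
  have "\<forall>\<^sub>F n in sequentially. \<forall>k\<in>K. x k n > 0"
    using assms(1) pos by (simp add: eventually_ball_finite_distrib)
  then have lower: "\<forall>\<^sub>F n in sequentially. 1 - sqrt (\<eta> n) \<le> measure_pmf.prob (P n) (good n)"
    using finP
  proof eventually_elim
    case (elim n)
    define bad where "bad k = {\<omega>. (X k n \<omega> - x k n)\<^sup>2 \<ge> (\<epsilon> n)\<^sup>2 * (x k n)\<^sup>2}" for k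
    have \<epsilon>2: "(\<epsilon> n)\<^sup>2 = sqrt (\<eta> n)" "\<epsilon> n > 0" using \<eta>_pos[of n] by (simp_all add: \<epsilon>_def)
    have bad: "measure_pmf.prob (P n) (bad k) \<le> \<delta> k n / sqrt (\<eta> n)" if "k \<in> K" for k
    proof -
      have "measure_pmf.prob (P n) {\<omega> \<in> space (measure_pmf (P n)). (\<epsilon> n)\<^sup>2 * (x k n)\<^sup>2 \<le> (X k n \<omega> - x k n)\<^sup>2} \<le>
          measure_pmf.expectation (P n) (\<lambda>\<omega>. (X k n \<omega> - x k n)\<^sup>2) / ((\<epsilon> n)\<^sup>2 * (x k n)\<^sup>2)"
        using elim that \<epsilon>2 \<eta>_pos[of n]
        by (intro integral_Markov_inequality_measure[where A = "{}"])
           (auto intro: integrable_measure_pmf_finite)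
      then show ?thesis using \<epsilon>2 by (simp add: bad_def \<delta>_def mult.commute)
    qed
    have "- good n \<subseteq> (\<Union>k\<in>K. bad k)"
    proof
      fix \<omega> assume "\<omega> \<in> - good n"
      then obtain k where k: "k \<in> K"
        "\<not> ((1 - \<epsilon> n) * x k n \<le> X k n \<omega> \<and> X k n \<omega> \<le> (1 + \<epsilon> n) * x k n)"
        by (auto simp: good_def)
      have "\<epsilon> n * x k n > 0" using \<epsilon>2 elim k(1) by simp
      then have "\<bar>\<epsilon> n * x k n\<bar> \<le> \<bar>X k n \<omega> - x k n\<bar>"
        using k(2) by (simp add: algebra_simps) linarith
      then have "(\<epsilon> n * x k n)\<^sup>2 \<le> (X k n \<omega> - x k n)\<^sup>2" by (simp only: abs_le_square_iff)
      then show "\<omega> \<in> (\<Union>k\<in>K. bad k)" using k(1) by (auto simp: bad_def power_mult_distrib)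
    qed
    then have "measure_pmf.prob (P n) (- good n) \<le> measure_pmf.prob (P n) (\<Union>k\<in>K. bad k)"
      by (intro measure_pmf.finite_measure_mono) auto
    also have "\<dots> \<le> (\<Sum>k\<in>K. measure_pmf.prob (P n) (bad k))"
      using assms(1) by (intro measure_pmf.finite_measure_subadditive_finite) auto
    also have "\<dots> \<le> (\<Sum>k\<in>K. \<delta> k n / sqrt (\<eta> n))" by (intro sum_mono bad)
    also have "\<dots> = (\<Sum>k\<in>K. \<delta> k n) / sqrt (\<eta> n)" by (simp add: sum_divide_distrib)
    also have "\<dots> \<le> \<eta> n / sqrt (\<eta> n)"
      using \<eta>_pos[of n] by (intro divide_right_mono) (auto simp: \<eta>_def)
    also have "\<dots> = sqrt (\<eta> n)" using \<eta>_pos[of n] by (simp add: real_div_sqrt)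
    finally show ?case
      using measure_pmf.prob_compl[of "good n" "P n"] by (simp add: Compl_eq_Diff_UNIV)
  qed
  have "(\<lambda>n. 1 - sqrt (\<eta> n)) \<longlonglongrightarrow> 1" using tendsto_diff[OF tendsto_const sqrt_\<eta>, of 1] by simp
  moreover have "\<forall>\<^sub>F n in sequentially. measure_pmf.prob (P n) (good n) \<le> 1" by simp
  ultimately have "(\<lambda>n. measure_pmf.prob (P n) (good n)) \<longlonglongrightarrow> 1"
    using tendsto_sandwich[OF lower _ _ tendsto_const] by blast
  then show ?thesis unfolding aas_asymp_equal_def good_def using \<epsilon> by blast
qed

text \<open>Passing to edge sets is a bijection, so the uniform distribution becomes the uniform one
  on \<open>m\<close>-subsets of the pairs. The bound on \<open>m\<close> makes the set of graphs
  nonempty, as \<open>pmf_of_set\<close> requires.\<close>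

lemma expectation_random_graph:
  fixes f :: "nat \<Rightarrow> real"
  assumes "m \<le> n choose 2"
  shows "measure_pmf.expectation (random_graph n m) (\<lambda>G. f (num_components k G)) =
    (\<Sum>E | E \<subseteq> vertex_pairs {1..n} \<and> card E = m. f (card {C \<in> classes {1..n} E. card C = k})) /
      ((n choose 2) choose m)"
    and "finite (set_pmf (random_graph n m))"
proof -
  let ?\<Omega> = "{E. E \<subseteq> vertex_pairs {1..n} \<and> card E = m}"
  have card: "card ?\<Omega> = (n choose 2) choose m" using card_graphs[of "{1..n}" m] by simp
  moreover have pos: "(n choose 2) choose m > 0" using assms by simp
  ultimately have \<Omega>: "finite ?\<Omega>" "?\<Omega> \<noteq> {}" by (metis card_gt_0_iff)+
  note bij = bij_betw_edges[of n m]
  have fin: "finite (labeled_graphs n m)" "labeled_graphs n m \<noteq> {}"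
    using bij_betw_finite[OF bij] \<Omega> bij_betw_empty2[of _ "labeled_graphs n m"] bij
      bij_betw_imp_surj_on[OF bij] by auto
  then show "finite (set_pmf (random_graph n m))" by (simp add: random_graph_def)
  have "(\<Sum>G\<in>labeled_graphs n m. f (num_components k G)) =
      (\<Sum>G\<in>labeled_graphs n m. f (card {C \<in> classes {1..n} (edges G). card C = k}))"
    by (intro sum.cong refl) (simp add: labeled_graphs_def num_components_eq)
  also have "\<dots> = (\<Sum>E\<in>?\<Omega>. f (card {C \<in> classes {1..n} E. card C = k}))"
    by (rule sum.reindex_bij_betw[OF bij])
  finally show "measure_pmf.expectation (random_graph n m) (\<lambda>G. f (num_components k G)) =
    (\<Sum>E\<in>?\<Omega>. f (card {C \<in> classes {1..n} E. card C = k})) / ((n choose 2) choose m)"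
    using fin card bij_betw_same_card[OF bij] by (simp add: random_graph_def integral_pmf_of_set)
qed

section \<open>Mean square deviation in the random graph\<close>

context edge_density
begin

text \<open>Here Cayley's formula turns the number of trees into the explicit power.\<close>

lemma limit_density_eq:
  assumes "k > 0"
  shows "limit_density k = real k powi (int k - 2) / fact k * (2 * c) ^ (k - 1) * exp (- 2 * real k * c)"
  using num_connected_tree[OF assms] by (simp add: limit_density_def mult_ac)

lemma limit_density_pos: "k > 0 \<Longrightarrow> limit_density k > 0"
  using c_pos by (simp add: limit_density_eq zero_less_power_int)

text \<open>Expanding the square leaves, on the scale \<open>n ^ 2\<close>, the contribution
  \<open>l\<^sup>2\<close> of disjoint pairs, the cross term with limit
  \<open>- 2 * l\<^sup>2\<close>, and \<open>l\<^sup>2\<close>; these cancel. The pairs of equal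
  sets contribute \<open>A1 n\<close>, which is only of order \<open>n\<close> relative to the
  number of graphs.\<close>

lemma mean_square_deviation_tendsto:
  assumes "k > 0"
  shows "(\<lambda>n. measure_pmf.expectation (random_graph n (m n))
      (\<lambda>G. (real (num_components k G) - limit_density k * n)\<^sup>2) / (limit_density k * n)\<^sup>2) \<longlonglongrightarrow> 0"
proof -
  define l where "l = limit_density k"
  have l: "l > 0" using limit_density_pos[OF assms] by (simp add: l_def)
  define B where "B n = real ((n choose 2) choose m n)" for n
  define A1 where "A1 n = real ((n choose k) * class_count k n (m n))" for n
  define A2 where "A2 n = real ((n choose k) * (n - k choose k) *
      (\<Sum>j\<le>m n. num_connected k j * class_count k (n - k) (m n - j)))" for n
  have A1: "(\<lambda>n. A1 n / B n / n) \<longlonglongrightarrow> l"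
    using first_moment_tendsto[OF assms] by (simp add: A1_def B_def l_def)
  have A2: "(\<lambda>n. A2 n / B n / (real n)\<^sup>2) \<longlonglongrightarrow> l\<^sup>2"
    using second_moment_tendsto[OF assms] by (simp add: A2_def B_def l_def)
  have "(\<lambda>n. 1 / real n) \<longlonglongrightarrow> 0" by real_asymp
  then have "(\<lambda>n. (A1 n / B n / n * (1 / real n) + A2 n / B n / (real n)\<^sup>2 - 2 * l * (A1 n / B n / n) + l\<^sup>2) / l\<^sup>2)
      \<longlonglongrightarrow> (l * 0 + l\<^sup>2 - 2 * l * l + l\<^sup>2) / l\<^sup>2"
    using l by (intro tendsto_intros A1 A2) auto
  then have 1: "(\<lambda>n. (A1 n / B n / n * (1 / real n) + A2 n / B n / (real n)\<^sup>2 - 2 * l * (A1 n / B n / n) + l\<^sup>2) / l\<^sup>2)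
      \<longlonglongrightarrow> 0"
    by (simp add: power2_eq_square)
  have 2: "\<forall>\<^sub>F n in sequentially.
      (A1 n / B n / n * (1 / real n) + A2 n / B n / (real n)\<^sup>2 - 2 * l * (A1 n / B n / n) + l\<^sup>2) / l\<^sup>2 =
      measure_pmf.expectation (random_graph n (m n)) (\<lambda>G. (real (num_components k G) - l * n)\<^sup>2) / (l * n)\<^sup>2"
    using eventually_edges_less[of 0] eventually_gt_at_top[of 0]
  proof eventually_elim
    case (elim n)
    let ?\<Omega> = "{E. E \<subseteq> vertex_pairs {1..n} \<and> card E = m n}"
    let ?X = "\<lambda>E. real (card {C \<in> classes {1..n} E. card C = k})"
    have mn: "m n \<le> n choose 2" using elim by simp
    then have B: "B n > 0" by (simp add: B_def)
    have "(\<Sum>E\<in>?\<Omega>. (?X E - l * n)\<^sup>2) = (\<Sum>E\<in>?\<Omega>. (?X E)\<^sup>2 - 2 * (l * n) * ?X E + (l * n)\<^sup>2)"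
      by (intro sum.cong refl) (simp add: power2_diff algebra_simps)
    also have "\<dots> = (\<Sum>E\<in>?\<Omega>. (?X E)\<^sup>2) - 2 * (l * n) * (\<Sum>E\<in>?\<Omega>. ?X E) + card ?\<Omega> * (l * n)\<^sup>2"
      by (simp only: sum.distrib sum_subtractf sum_constant sum_distrib_left)
    also have "(\<Sum>E\<in>?\<Omega>. ?X E) = A1 n"
      using sum_card_classes[of "{1..n}"] by (simp add: A1_def)
    also have "(\<Sum>E\<in>?\<Omega>. (?X E)\<^sup>2) = A1 n + A2 n"
      using sum_card_classes_squared[of "{1..n}" k] assms by (simp add: A1_def A2_def)
    also have "card ?\<Omega> = B n"
      using card_graphs[of "{1..n}" "m n"] by (simp add: B_def)
    finally have sum: "(\<Sum>E\<in>?\<Omega>. (?X E - l * n)\<^sup>2) = A1 n + A2 n - 2 * (l * n) * A1 n + B n * (l * n)\<^sup>2" .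
    have eq: "measure_pmf.expectation (random_graph n (m n)) (\<lambda>G. (real (num_components k G) - l * n)\<^sup>2) =
        (A1 n + A2 n - 2 * (l * n) * A1 n + B n * (l * n)\<^sup>2) / B n"
      using expectation_random_graph(1)[OF mn, of "\<lambda>x. (real x - l * n)\<^sup>2" k] sum
      by (simp add: B_def)
    show ?case
    proof -
      have "A1 n / B n / n * (1 / real n) + A2 n / B n / (real n)\<^sup>2 - 2 * l * (A1 n / B n / n) + l\<^sup>2 =
          (A1 n + A2 n - 2 * (l * n) * A1 n + B n * (l * n)\<^sup>2) / B n / (real n)\<^sup>2"
        using B elim by (simp add: add_divide_distrib diff_divide_distrib power2_eq_square)
      then show ?thesis unfolding eq by (simp add: power_mult_distrib)
    qed
  qed
  show ?thesis using Lim_transform_eventually[OF 1 2] by (simp add: l_def)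
qed

end

section \<open>The edge numbers \<open>\<lfloor>c * n\<rfloor>\<close> and the conclusion\<close>

lemma floor_density:
  assumes "c > 0"
  shows "(\<lambda>n. nat \<lfloor>c * real n\<rfloor> / n) \<longlonglongrightarrow> c"
proof (rule tendsto_sandwich)
  show "(\<lambda>n. c - 1 / real n) \<longlonglongrightarrow> c" by real_asymp
  show "(\<lambda>_. c) \<longlonglongrightarrow> c" by simp
  have floor: "c * real n - 1 \<le> nat \<lfloor>c * real n\<rfloor> \<and> nat \<lfloor>c * real n\<rfloor> \<le> c * real n" for n
    using assms by (simp add: of_nat_floor)
  show "\<forall>\<^sub>F n in sequentially. c - 1 / real n \<le> nat \<lfloor>c * real n\<rfloor> / n"
    using eventually_gt_at_top[of 0]
  proof eventually_elim
    case (elim n)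
    then have "c - 1 / real n = (c * real n - 1) / n" by (simp add: field_simps)
    also have "\<dots> \<le> nat \<lfloor>c * real n\<rfloor> / n"
      using floor[of n] by (intro divide_right_mono) auto
    finally show ?case .
  qed
  show "\<forall>\<^sub>F n in sequentially. nat \<lfloor>c * real n\<rfloor> / n \<le> c"
    using eventually_gt_at_top[of 0]
  proof eventually_elim
    case (elim n)
    then show ?case using floor[of n] by (simp add: field_simps)
  qed
qed

theorem theorem1p2:
  fixes \<kappa> :: nat and c :: real
  assumes "\<kappa> \<ge> 1" and "c > 0"
  shows "aas_asymp_equal {1..\<kappa>}
           (\<lambda>n. random_graph n (nat \<lfloor>c * real n\<rfloor>))
           (\<lambda>k n G. real (num_components k G))
           (\<lambda>k n. real k powi (int k - 2) / fact k * (2 * c) ^ (k - 1) * exp (- 2 * real k * c) * real n)"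
proof -
  interpret edge_density "\<lambda>n. nat \<lfloor>c * real n\<rfloor>" c
    using assms floor_density by unfold_locales auto
  show ?thesis
  proof (rule aas_asymp_equalI_second_moment)
    \<comment> \<open>For small \<open>n\<close> the floor may exceed \<open>n choose 2\<close>, and
      then nothing is known about the distribution.\<close>
    show "\<forall>\<^sub>F n in sequentially. finite (set_pmf (random_graph n (nat \<lfloor>c * real n\<rfloor>)))"
      using eventually_edges_less[of 0]
      by eventually_elim (simp add: expectation_random_graph(2))
    fix k assume "k \<in> {1..\<kappa>}"
    then have k: "k > 0" by simp
    show "\<forall>\<^sub>F n in sequentially.
        real k powi (int k - 2) / fact k * (2 * c) ^ (k - 1) * exp (- 2 * real k * c) * real n > 0"
      unfolding limit_density_eq[OF k, symmetric] using eventually_gt_at_top[of 0]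
      by eventually_elim (simp add: limit_density_pos[OF k])
    show "(\<lambda>n. measure_pmf.expectation (random_graph n (nat \<lfloor>c * real n\<rfloor>))
        (\<lambda>G. (real (num_components k G) -
          real k powi (int k - 2) / fact k * (2 * c) ^ (k - 1) * exp (- 2 * real k * c) * real n)\<^sup>2) /
        (real k powi (int k - 2) / fact k * (2 * c) ^ (k - 1) * exp (- 2 * real k * c) * real n)\<^sup>2)
        \<longlonglongrightarrow> 0"
      using mean_square_deviation_tendsto[OF k] by (simp only: limit_density_eq[OF k])
  qed simp
qed

end
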